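(* Let $B=\{B_\eta\in\mathbb R^+:\eta\in H\}$ satisfy $B_{\eta_1}B_{\eta_2}\le B_{\eta}$ for all $\eta,\eta_1,\eta_2\in H$ with $\eta=\eta_1+\eta_2$. Suppose that the map $\rho^<$ is such that $$\rho^<(\bullet_\eta)=\sum_{1\le i\le\nu}u^i_\eta x^\eta x_i\partial_{x_i}\qquad(\eta\in H)$$ with $|u^i_\eta|\le B_\eta A^{|\eta|}$ for some $A>0$. If $\chi$ is a (complex-valued) character on $\mathrm{CK}_H^+$ for which there is a constant $C>0$ with $|\chi(F)|\le C^{\mathrm{gr}(F)}$ for all forests $F\in\mathcal F_H^+$, then the formal diffeomorphism $\varphi$ such that $$\Theta_\varphi=\sum_{F\in\mathcal F_H^+}\chi(F)\,\rho^<(F)$$ is in $\mathbf G_B$.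
   Context: Fix $\nu\ge1$, $x=(x_1,\dots,x_\nu)$, and let $e_i$ be the $i$-th canonical basis vector of $\mathbb{Z}^\nu$. For $1\le i\le\nu$ let $H_i=\{n-e_i:\ n\in\mathbb{N}^\nu,\ |n|\ge 2\}$ ($\mathbb N\ni0$, $|n|=n_1+\dots+n_\nu$) and $H=H_1\cup\dots\cup H_\nu$. Put $x^\eta=x_1^{\eta_1}\cdots x_\nu^{\eta_\nu}$ and $|\eta|=\eta_1+\dots+\eta_\nu$. $\mathbf G$ is the group of formal tangent-to-identity diffeomorphisms $\varphi=(\varphi_1,\dots,\varphi_\nu)$, $\varphi_i(x)=x_i(1+\sum_{\eta\in H_i}\varphi^i_\eta x^\eta)$, and $\Theta_\varphi$ is the substitution automorphism $\Theta_\varphi.g=g\circ\varphi$ of $\mathbb C[[x]]$. $\mathbf G_B$ is the set of $\varphi\in\mathbf G$ for which there exists $A'>0$ with $|\varphi^i_\eta|\le B_\eta A'^{|\eta|}$ for all $1\le i\le\nu$, $\eta\in H_i$. $\mathcal F_H$ is the set of forests (commutative products, including the empty one $\emptyset$) of non-planar rooted trees with vertices decorated by $H$. $B^+_\eta(F)$ is the tree obtained by joining the roots of $F$ to a new root decorated by $\eta$, and $\bullet_\eta=B_\eta^+(\emptyset)$. $\|F\|$ is the sum of the decorations of $F$ and $\mathrm{gr}(F)$ is the sum of the $|\eta|$ over the decorations $\eta$ of $F$. An admissible cut $c$ of a tree $T$ is a set of vertices such that on the path from the root to an element of $c$ no other vertex of $c$ is encountered; $P^c(T)$ is the product of the subtrees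 with roots in $c$ and $R^c(T)$ is the remaining tree (the empty cut is allowed). $\mathcal T^+_H$ is the set of trees $T$ such that for every admissible cut $c$, $R^c(T)$ (if nonempty) and all tree factors of $P^c(T)$ have weight $\|\cdot\|$ in $H$. $\mathcal F^+_H$ is the set of forests of trees in $\mathcal T^+_H$ (including $\emptyset$), and $\mathrm{CK}_H^+$ is the linear span of $\mathcal F_H^+$, a sub-Hopf algebra of the Connes–Kreimer Hopf algebra $\mathrm{CK}_H$ (product: disjoint union of forests; coproduct on trees $\Delta(T)=\sum_{c}P^c(T)\otimes R^c(T)$, over admissible cuts). A character is a morphism of unital algebras to $\mathbb C$. Given complex coefficients $u^i_\eta$ ($u^i_\eta=0$ if $\eta\notin H_i$), $\rho^<(F)$ is the polynomial-coefficient differential operator defined recursively by: $\rho^<(\emptyset)=\mathrm{Id}$; for a tree $T=B^+_\eta(F)$, $\rho^<(T)=\sum_{i=1}^\nu(\rho^<(F).(u^i_\eta x^\eta x_i))\partial_{x_i}$; for $F=T_1\cdots T_s$ with $s\ge2$ trees, consisting of $k$ distinct decorated trees with multiplicities $d_1,\dots,d_k$, $\rho^<(F)=\frac{1}{d_1!\cdots d_k!}\sum_{1\le i_1,\dots,i_s\le\nu}(\rho^<(T_1).x_{i_1})\cdots(\rho^<(T_s).x_{i_s})\partial_{x_{i_1}}\cdots\partial_{x_{i_s}}$. The sum defining $\Theta_\varphi$ is a well-defined operator on $\mathbb C[[x]]$ since only finitely many forests have a given grade and $\rho^<(F)$ raises total degree by $\mathrm{gr}(F)$. *)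

theory Defs
  imports
    "HOL-Analysis.Finite_Cartesian_Product"
    "HOL-Library.Multiset"
    "HOL-Library.Poly_Mapping"
begin

section \<open>The index sets\<close>

text \<open>The number of variables is the cardinality of the (nonempty, finite) index type \<open>'n\<close>;
  the canonical basis vector \<open>e\<^sub>i\<close> is \<^term>\<open>axis i 1\<close>.\<close>

definition deg :: "int ^ 'n \<Rightarrow> int" where
  "deg \<eta> = (\<Sum>i\<in>UNIV. \<eta> $ i)"

definition vint :: "nat ^ 'n \<Rightarrow> int ^ 'n" where
  "vint n = (\<chi> j. int (n $ j))"

definition H_comp :: "'n \<Rightarrow> (int ^ 'n) set" where
  "H_comp i = {vint n - axis i 1 | n. deg (vint n) \<ge> 2}"

definition H :: "(int ^ 'n) set" where
  "H = (\<Union>i\<in>UNIV. H_comp i)"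


section \<open>Formal power series in several variables\<close>

typedef 'n mps = "UNIV :: (nat ^ 'n \<Rightarrow> complex) set"
  morphisms coeff Abs_mps by simp

setup_lifting type_definition_mps

lemma mps_eqI: "(\<And>m. coeff f m = coeff g m) \<Longrightarrow> f = g"
  by (metis coeff_inject ext)

lemma finite_vec_sums: "finite {(a, b). a + b = (m :: nat ^ 'n)}"
proof -
  let ?S = "{a :: nat ^ 'n. \<forall>i. a $ i \<le> m $ i}"
  have "vec_nth ` ?S \<subseteq> PiE UNIV (\<lambda>i. {..m $ i})"
    by auto
  then have "finite (vec_nth ` ?S)"
    by (rule finite_subset) (intro finite_PiE; simp)
  then have "finite ?S"
    by (rule finite_imageD) (simp add: inj_on_def vec_nth_inject)
  moreover have "{(a, b). a + b = m} \<subseteq> ?S \<times> ?S"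
    by auto
  ultimately show ?thesis
    by (meson finite_SigmaI finite_subset)
qed

instantiation mps :: (finite) comm_ring_1
begin

lift_definition zero_mps :: "'a mps" is "\<lambda>_. 0" .
lift_definition one_mps :: "'a mps" is "\<lambda>m. if m = 0 then 1 else 0" .
lift_definition plus_mps :: "'a mps \<Rightarrow> 'a mps \<Rightarrow> 'a mps" is "\<lambda>f g m. f m + g m" .
lift_definition uminus_mps :: "'a mps \<Rightarrow> 'a mps" is "\<lambda>f m. - f m" .
lift_definition minus_mps :: "'a mps \<Rightarrow> 'a mps \<Rightarrow> 'a mps" is "\<lambda>f g m. f m - g m" .
lift_definition times_mps :: "'a mps \<Rightarrow> 'a mps \<Rightarrow> 'a mps"
  is "\<lambda>f g m. \<Sum>(a, b)\<in>{(a, b). a + b = m}. f a * g b" .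

instance
proof
  fix f g h :: "'a mps"
  show "f * g * h = f * (g * h)"
  proof (rule mps_eqI)
    fix m
    have "coeff (f * g * h) m =
        (\<Sum>(a, d)\<in>{(a, d). a + d = m}. \<Sum>(b, c)\<in>{(b, c). b + c = a}.
          coeff f b * coeff g c * coeff h d)"
      by (simp add: times_mps.rep_eq sum_distrib_right split_def)
    also have "\<dots> = (\<Sum>p\<in>(SIGMA p:{(a, d). a + d = m}. {(b, c). b + c = fst p}).
          coeff f (fst (snd p)) * coeff g (snd (snd p)) * coeff h (snd (fst p)))"
      by (simp add: split_def) (subst sum.Sigma; simp add: split_def finite_vec_sums [unfolded split_def])
    also have "\<dots> = (\<Sum>p\<in>(SIGMA p:{(b, a). b + a = m}. {(c, d). c + d = snd p}).
          coeff f (fst (fst p)) * (coeff g (fst (snd p)) * coeff h (snd (snd p))))"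
      by (rule sum.reindex_bij_witness
          [of _ "\<lambda>((b, a), (c, d)). ((b + c, d), (b, c))" "\<lambda>((a, d), (b, c)). ((b, c + d), (c, d))"])
        (auto simp: ac_simps)
    also have "\<dots> = (\<Sum>(b, a)\<in>{(b, a). b + a = m}. \<Sum>(c, d)\<in>{(c, d). c + d = a}.
          coeff f b * (coeff g c * coeff h d))"
      by (simp add: split_def) (subst sum.Sigma; simp add: split_def finite_vec_sums [unfolded split_def])
    also have "\<dots> = coeff (f * (g * h)) m"
      by (simp add: times_mps.rep_eq sum_distrib_left split_def)
    finally show "coeff (f * g * h) m = coeff (f * (g * h)) m" .
  qed
  show "f * g = g * f"
    unfolding times_mps_def map_fun_def o_def
    by (intro arg_cong [where f = Abs_mps] ext
        sum.reindex_bij_witness [of _ "\<lambda>(a, b). (b, a)" "\<lambda>(a, b). (b, a)"])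
      (auto simp: ac_simps)
  show "1 * f = f"
  proof (rule mps_eqI)
    fix m
    have "coeff (1 * f) m =
        (\<Sum>p\<in>{(a, b). a + b = m}. if p = (0, m) then coeff f m else 0)"
      unfolding times_mps.rep_eq one_mps.rep_eq by (rule sum.cong) (auto split: if_splits)
    also have "\<dots> = coeff f m"
      by (subst sum.delta) (auto simp: finite_vec_sums)
    finally show "coeff (1 * f) m = coeff f m" .
  qed
  show "(f + g) * h = f * h + g * h"
    by (rule mps_eqI)
      (simp add: times_mps.rep_eq plus_mps.rep_eq distrib_right split_def sum.distrib)
  show "f + g + h = f + (g + h)" "f + g = g + f" "0 + f = f" "- f + f = 0" "f - g = f + - g"
    by (transfer; simp add: ac_simps)+
  show "(0 :: 'a mps) \<noteq> 1"
    by transfer (metis zero_neq_one)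
qed

end

text \<open>The monomial \<open>c x\<^sup>\<alpha>\<close> is indexed by an integer exponent vector, so that \<open>x\<^sup>\<eta> x\<^sub>i\<close> can be written
  for \<open>\<eta>\<close> with an entry \<open>-1\<close>; it is \<open>0\<close> if \<open>\<alpha>\<close> has a negative entry.\<close>

lift_definition monom :: "complex \<Rightarrow> int ^ 'n \<Rightarrow> 'n::finite mps"
  is "\<lambda>c \<alpha> m. if vint m = \<alpha> then c else 0" .

abbreviation const :: "complex \<Rightarrow> 'n::finite mps" where
  "const c \<equiv> monom c 0"

definition X :: "'n \<Rightarrow> 'n::finite mps" where
  "X i = monom 1 (axis i 1)"

lift_definition pd :: "'n \<Rightarrow> 'n::finite mps \<Rightarrow> 'n mps"
  is "\<lambda>i f m. of_nat (m $ i + 1) * f (m + axis i 1)" .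

text \<open>Coefficientwise sum of a family of which only finitely many members contribute to each
  coefficient; a coefficient with infinitely many nonzero contributions would be set to \<open>0\<close>.\<close>

lift_definition formal_sum :: "('a \<Rightarrow> 'n::finite mps) \<Rightarrow> 'a set \<Rightarrow> 'n mps"
  is "\<lambda>f A m. \<Sum>a\<in>{a \<in> A. f a m \<noteq> 0}. f a m" .


section \<open>Formal tangent-to-identity diffeomorphisms\<close>

definition diffeo :: "('n \<Rightarrow> int ^ 'n \<Rightarrow> complex) \<Rightarrow> 'n \<Rightarrow> 'n::finite mps" where
  "diffeo p i = X i + formal_sum (\<lambda>\<eta>. monom (p i \<eta>) (\<eta> + axis i 1)) (H_comp i)"

definition G :: "('n \<Rightarrow> 'n::finite mps) set" where
  "G = {diffeo p | p. True}"

definition G_weighted :: "(int ^ 'n \<Rightarrow> real) \<Rightarrow> ('n \<Rightarrow> 'n::finite mps) set" where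
  "G_weighted B =
    {diffeo p | p. \<exists>A'>0. \<forall>i. \<forall>\<eta>\<in>H_comp i. norm (p i \<eta>) \<le> B \<eta> * A' powi deg \<eta>}"

text \<open>The sum in \<open>Theta \<phi> g\<close> is locally finite for \<open>\<phi> \<in> G\<close>, because the \<open>\<phi> i\<close> have no constant term.\<close>

definition Theta :: "('n \<Rightarrow> 'n mps) \<Rightarrow> 'n::finite mps \<Rightarrow> 'n mps" where
  "Theta \<phi> g = formal_sum (\<lambda>n. const (coeff g n) * (\<Prod>i\<in>UNIV. \<phi> i ^ (n $ i))) UNIV"


section \<open>Decorated trees and forests\<close>

datatype 'a rtree = Node 'a "'a rtree multiset"

type_synonym 'a forest = "'a rtree multiset"

primrec weight :: "'a::comm_monoid_add rtree \<Rightarrow> 'a" where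
  "weight (Node \<eta> F) = \<eta> + \<Sum>\<^sub># (image_mset weight F)"

primrec gr_tree :: "(int ^ 'n) rtree \<Rightarrow> int" where
  "gr_tree (Node \<eta> F) = deg \<eta> + \<Sum>\<^sub># (image_mset gr_tree F)"

definition gr :: "(int ^ 'n) forest \<Rightarrow> int" where
  "gr F = (\<Sum>T\<in>#F. gr_tree T)"

text \<open>A set of vertices of a tree is given by a boolean mark on every vertex, that is, by a tree
  over \<^typ>\<open>'a \<times> bool\<close> that becomes the given tree when the marks are erased.  Cuts that differ by
  an automorphism of the tree are thus identified; they have the same pruned part and the same
  remainder.\<close>

primrec admissible :: "('a \<times> bool) rtree \<Rightarrow> bool" where
  "admissible (Node v F) \<longleftrightarrow>
    (\<forall>b\<in>#image_mset admissible F. b) \<and>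
    (snd v \<longrightarrow> (\<forall>S\<in>#F. \<forall>w\<in>set_rtree S. \<not> snd w))"

primrec pruned :: "('a \<times> bool) rtree \<Rightarrow> 'a forest" where
  "pruned (Node v F) =
    (if snd v then {#Node (fst v) (image_mset (map_rtree fst) F)#}
     else \<Sum>\<^sub># (image_mset pruned F))"

text \<open>The remainder has at most one tree, and is empty iff the root belongs to the cut.\<close>

primrec remainder :: "('a \<times> bool) rtree \<Rightarrow> 'a forest" where
  "remainder (Node v F) =
    (if snd v then {#} else {#Node (fst v) (\<Sum>\<^sub># (image_mset remainder F))#})"

definition trees_plus :: "(int ^ 'n) rtree set" where
  "trees_plus = {T. set_rtree T \<subseteq> H \<and>
    (\<forall>c. map_rtree fst c = T \<and> admissible c \<longrightarrow>
      (\<forall>S\<in>#remainder c + pruned c. weight S \<in> H))}"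

definition forests_plus :: "(int ^ 'n) forest set" where
  "forests_plus = {F. set_mset F \<subseteq> trees_plus}"


section \<open>Characters\<close>

text \<open>As an algebra, the Connes--Kreimer algebra is the monoid algebra of the monoid of forests
  under disjoint union, which is the convolution product on \<^typ>\<open>'a forest \<Rightarrow>\<^sub>0 complex\<close>;
  its unit is the empty forest.\<close>

definition scale :: "complex \<Rightarrow> ('a forest \<Rightarrow>\<^sub>0 complex) \<Rightarrow> ('a forest \<Rightarrow>\<^sub>0 complex)" where
  "scale c a = Poly_Mapping.single 0 c * a"

global_interpretation CK: module "scale :: complex \<Rightarrow> ('a forest \<Rightarrow>\<^sub>0 complex) \<Rightarrow> _"
  by unfold_locales
    (simp_all add: scale_def algebra_simps single_add mult_single flip: mult.assoc)

definition basis_forest :: "'a forest \<Rightarrow> ('a forest \<Rightarrow>\<^sub>0 complex)" where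
  "basis_forest F = Poly_Mapping.single F 1"

definition CK_plus :: "((int ^ 'n) forest \<Rightarrow>\<^sub>0 complex) set" where
  "CK_plus = CK.span (basis_forest ` forests_plus)"

definition character :: "(((int ^ 'n) forest \<Rightarrow>\<^sub>0 complex) \<Rightarrow> complex) \<Rightarrow> bool" where
  "character f \<longleftrightarrow> f 1 = 1 \<and>
    (\<forall>a\<in>CK_plus. \<forall>b\<in>CK_plus. f (a + b) = f a + f b \<and> f (a * b) = f a * f b) \<and>
    (\<forall>c. \<forall>a\<in>CK_plus. f (scale c a) = c * f a)"


section \<open>The operators attached to forests\<close>

text \<open>For operators \<open>D\<^sub>1, \<dots>, D\<^sub>s\<close>, the operator
  \<open>\<Sum> (D\<^sub>1.x\<^bsub>i\<^sub>1\<^esub>) \<cdots> (D\<^sub>s.x\<^bsub>i\<^sub>s\<^esub>) \<partial>\<^bsub>i\<^sub>1\<^esub> \<cdots> \<partial>\<^bsub>i\<^sub>s\<^esub>\<close>.\<close>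

definition normal_product :: "('n mps \<Rightarrow> 'n mps) list \<Rightarrow> 'n::finite mps \<Rightarrow> 'n mps" where
  "normal_product Ds g =
    (\<Sum>is\<in>{is :: 'n list. length is = length Ds}.
      (\<Prod>j<length Ds. (Ds ! j) (X (is ! j))) * foldr pd is g)"

text \<open>The multiset of operators is enumerated in an arbitrary order, on which the result does not
  depend (see \<open>rho_mset\<close> below).  The multiplicities are those of the trees in \<open>F\<close>, not of the
  operators, because distinct trees may give the same operator.\<close>

definition forest_op :: "'a multiset \<Rightarrow> ('n mps \<Rightarrow> 'n mps) multiset \<Rightarrow> 'n::finite mps \<Rightarrow> 'n mps" where
  "forest_op F M g =
    const (1 / (\<Prod>T\<in>set_mset F. fact (count F T))) * normal_product (SOME Ds. mset Ds = M) g"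

primrec rho_tree ::
  "('n \<Rightarrow> int ^ 'n \<Rightarrow> complex) \<Rightarrow> (int ^ 'n) rtree \<Rightarrow> 'n::finite mps \<Rightarrow> 'n mps" where
  "rho_tree u (Node \<eta> F) = (\<lambda>g. \<Sum>i\<in>UNIV.
    forest_op F (image_mset (rho_tree u) F) (monom (u i \<eta>) (\<eta> + axis i 1)) * pd i g)"

definition rho ::
  "('n \<Rightarrow> int ^ 'n \<Rightarrow> complex) \<Rightarrow> (int ^ 'n) forest \<Rightarrow> 'n::finite mps \<Rightarrow> 'n mps" where
  "rho u F = forest_op F (image_mset (rho_tree u) F)"

text \<open>The sum is locally finite if \<open>u i \<eta> = 0\<close> for \<open>\<eta> \<notin> H_comp i\<close>: then \<open>rho u F\<close> raises the total degree
  by \<open>gr F\<close>, and there are only finitely many forests of a given grade.\<close>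

definition forest_series ::
  "(((int ^ 'n) forest \<Rightarrow>\<^sub>0 complex) \<Rightarrow> complex) \<Rightarrow> ('n \<Rightarrow> int ^ 'n \<Rightarrow> complex) \<Rightarrow>
    'n::finite mps \<Rightarrow> 'n mps" where
  "forest_series f u g = formal_sum (\<lambda>F. const (f (basis_forest F)) * rho u F g) forests_plus"

lemma pd_commute: "pd i (pd j g) = pd j (pd i g)"
proof (rule mps_eqI)
  fix m
  show "coeff (pd i (pd j g)) m = coeff (pd j (pd i g)) m"
    by (cases "i = j") (simp_all add: pd.rep_eq axis_def ac_simps)
qed

lemma pd_X: "pd i (X j) = (if i = j then 1 else 0)"
proof (rule mps_eqI)
  fix m :: "nat ^ 'a"
  have "vint (m + axis i 1) = axis j 1 \<longleftrightarrow> m = 0 \<and> i = j"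
  proof
    assume *: "vint (m + axis i 1) = axis j 1"
    have eq: "m $ k + (if k = i then 1 else 0) = (if k = j then 1 else 0)" for k
      using arg_cong [OF *, of "\<lambda>v. v $ k"] by (auto simp: vint_def axis_def split: if_splits)
    from eq [of i] have "i = j" by (auto split: if_splits)
    moreover from this eq have "m = 0" by (auto simp: vec_eq_iff)
    ultimately show "m = 0 \<and> i = j" by simp
  qed (auto simp: vint_def axis_def vec_eq_iff)
  then show "coeff (pd i (X j)) m = coeff (if i = j then 1 else 0) m"
    by (auto simp: pd.rep_eq X_def monom.rep_eq one_mps.rep_eq zero_mps.rep_eq)
qed

lemma const_1: "const 1 = (1 :: 'n::finite mps)"
  by (rule mps_eqI) (auto simp: monom.rep_eq one_mps.rep_eq vint_def vec_eq_iff)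

lemma foldr_pd_commute: "pd i (foldr pd is g) = foldr pd is (pd i g)"
  by (induction "is") (simp_all, metis pd_commute)

lemma normal_product_Nil: "normal_product [] = (\<lambda>g. g)"
  by (rule ext) (simp add: normal_product_def)

lemma normal_product_Cons:
  "normal_product (D # Ds) g = (\<Sum>i\<in>UNIV. D (X i) * normal_product Ds (pd i g))"
proof -
  let ?L = "{is. length is = length Ds}"
  have "normal_product (D # Ds) g = (\<Sum>(i, is)\<in>UNIV \<times> ?L.
      D (X i) * ((\<Prod>j<length Ds. (Ds ! j) (X (is ! j))) * foldr pd is (pd i g)))"
    unfolding normal_product_def
    by (rule sum.reindex_bij_witness [of _ "\<lambda>(i, is). i # is" "\<lambda>is. (hd is, tl is)"])
      (auto simp: length_Suc_conv prod.lessThan_Suc_shift foldr_pd_commute mult.assoc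
        simp del: prod.lessThan_Suc)
  then show ?thesis
    by (simp add: normal_product_def sum_distrib_left sum.cartesian_product)
qed

lemma normal_product_cong:
  assumes "mset Ds = mset Es"
  shows "normal_product Ds = normal_product Es"
proof -
  define step where "step = (\<lambda>D K g. \<Sum>i\<in>UNIV. (D :: 'a mps \<Rightarrow> 'a mps) (X i) * K (pd i g))"
  have foldr: "normal_product Ds = foldr step Ds (\<lambda>g. g)" for Ds
    by (induction Ds) (simp_all add: normal_product_Nil normal_product_Cons step_def fun_eq_iff)
  have "step D \<circ> step E = step E \<circ> step D" for D E
  proof (intro ext)
    fix K g
    have "(step D \<circ> step E) K g =
        (\<Sum>i\<in>UNIV. \<Sum>j\<in>UNIV. D (X i) * (E (X j) * K (pd j (pd i g))))"
      by (simp add: step_def sum_distrib_left)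
    also have "\<dots> = (\<Sum>j\<in>UNIV. \<Sum>i\<in>UNIV. E (X j) * (D (X i) * K (pd i (pd j g))))"
      by (subst sum.swap) (simp add: pd_commute mult.left_commute)
    also have "\<dots> = (step E \<circ> step D) K g"
      by (simp add: step_def sum_distrib_left)
    finally show "(step D \<circ> step E) K g = (step E \<circ> step D) K g" .
  qed
  then have "fold step (rev Ds) = fold step (rev Es)"
    using assms by (intro fold_multiset_equiv) auto
  then show ?thesis
    by (simp add: foldr foldr_conv_fold)
qed

lemma rho_mset:
  "rho u (mset Ts) g =
    const (1 / (\<Prod>T\<in>set Ts. fact (count (mset Ts) T))) * normal_product (map (rho_tree u) Ts) g"
proof -
  have "mset (SOME Ds. mset Ds = image_mset (rho_tree u) (mset Ts)) = mset (map (rho_tree u) Ts)"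
    by (rule someI2 [of _ "map (rho_tree u) Ts"]) simp_all
  from normal_product_cong [OF this] show ?thesis
    unfolding rho_def forest_op_def by simp
qed

lemma rho_empty: "rho u {#} g = g"
  using rho_mset [of u "[]" g] by (simp add: normal_product_Nil const_1)

lemma rho_tree_Node:
  "rho_tree u (Node \<eta> F) g = (\<Sum>i\<in>UNIV. rho u F (monom (u i \<eta>) (\<eta> + axis i 1)) * pd i g)"
  by (simp add: rho_def)

declare rho_tree.simps [simp del]

lemma rho_tree_X: "rho_tree u (Node \<eta> F) (X i) = rho u F (monom (u i \<eta>) (\<eta> + axis i 1))"
  by (simp add: rho_tree_Node pd_X if_distrib [of "(*) _"] cong: if_cong)

lemma rho_singleton: "rho u {#T#} g = rho_tree u T g"
proof (cases T)
  case (Node \<eta> F)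
  show ?thesis
    using rho_mset [of u "[T]" g]
    by (simp add: Node normal_product_Cons normal_product_Nil const_1 rho_tree_X)
      (simp add: rho_tree_Node)
qed

lemma rho_bullet:
  "rho u {#Node \<eta> {#}#} g = (\<Sum>i\<in>UNIV. monom (u i \<eta>) (\<eta> + axis i 1) * pd i g)"
  by (simp add: rho_singleton rho_tree_Node rho_empty)

end

theory Submission
  imports Defs "HOL-Combinatorics.Multiset_Permutations"
begin

text \<open>
  Let \<open>L\<close> be the sum of \<open>\<chi>(F) \<rho>(F)\<close> over the forests \<open>F\<close>.

  Why \<open>L\<close> is a substitution.  A forest of \<open>s\<close> trees with its symmetry factor stands for \<open>1/s!\<close>
  times the sum of its orderings, and the character is multiplicative.  Hence \<open>L\<close> is the normally ordered
  exponential of the formal vector field \<open>V = \<Sum> \<chi>(T) \<rho>(T)\<close>, a sum over single trees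
  (\<open>sum_forests_eq_taylor\<close>); that is, \<open>L\<close> is the Taylor shift \<open>g(x) \<mapsto> g(x + V(x))\<close>.  By the Leibniz rule it is
  multiplicative (\<open>taylor_mult\<close>), and a linear, multiplicative operator that does not lower orders is the substitution of the
  series \<open>L x\<^sub>i\<close> for the \<open>x\<^sub>i\<close> (\<open>substitution_operator_eq_Theta\<close>).  Products and infinite sums are handled
  modulo series of high order, where all sums over trees and forests are finite.  The diffeomorphism
  is \<open>\<phi>\<^sub>i = L x\<^sub>i = x\<^sub>i + \<Sum> \<chi>(T) \<rho>(T) x\<^sub>i\<close>, and it is determined by \<open>L\<close> since \<open>\<Theta>\<^sub>\<phi> x\<^sub>i = \<phi>\<^sub>i\<close>.

  Why its coefficients are bounded.  The series \<open>\<rho>(T) x\<^sub>i\<close> is a monomial with exponent \<open>\<parallel>T\<parallel> + e\<^sub>i\<close>, and its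
  coefficient is at most the product of the bounds for the \<open>u\<^sub>\<eta>\<close> over the decorations \<open>\<eta>\<close> of \<open>T\<close>, times a
  combinatorial factor (\<open>rho_tree_monom_bounded\<close>).  The product of the \<open>B\<^sub>\<eta>\<close> is at most \<open>B\<close> at \<open>\<parallel>T\<parallel>\<close>: if \<open>T\<close> is
  assembled vertex by vertex from the root, the intermediate trees are remainders of admissible cuts, so
  their weights stay in \<open>H\<close> and the inequality for \<open>B\<close> can be applied at each vertex
  (\<open>deco_prod_le_weight\<close>).  The combinatorial factors are such that their generating function \<open>g(t)\<close>, over all
  trees with decorations in \<open>H\<close>, satisfies \<open>g(t) = \<Sum> t\<^bsup>|\<eta>|\<^esup> (1 + g(t))\<^bsup>|\<eta>| + 1\<^esup>\<close>, the sum being over \<open>\<eta> \<in> H\<close>.  For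
  small \<open>t\<close> the bound \<open>g(t) \<le> 1\<close> propagates through the truncations of \<open>g\<close> by the grade
  (\<open>sum_trees_upto_le_1\<close>), so the factors of all trees of grade \<open>k\<close> have a sum of at most \<open>t\<^bsup>-k\<^esup>\<close>.
\<close>

(* The simplifier would rewrite axis i 1 over the natural numbers to axis i (Suc 0), and the rules
   about unit vectors would no longer match. *)
declare One_nat_def [simp del]

section \<open>Total degree, monomials and derivations\<close>

definition total_degree :: "nat ^ 'n::finite \<Rightarrow> nat" where
  "total_degree m = (\<Sum>i\<in>UNIV. m $ i)"

lemma total_degree_add: "total_degree (a + b) = total_degree a + total_degree b"
  by (simp add: total_degree_def sum.distrib)

lemma total_degree_axis [simp]: "total_degree (axis i 1) = 1"
  by (simp add: total_degree_def axis_def)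

lemma deg_vint [simp]: "deg (vint m) = int (total_degree m)"
  by (simp add: deg_def vint_def total_degree_def)

lemma deg_add: "deg (a + b) = deg a + deg b"
  by (simp add: deg_def sum.distrib)

lemma deg_diff: "deg (a - b) = deg a - deg b"
  by (simp add: deg_def sum_subtractf)

lemma deg_0 [simp]: "deg 0 = 0"
  by (simp add: deg_def)

lemma deg_axis [simp]: "deg (axis i 1 :: int ^ 'n::finite) = 1"
  by (simp add: deg_def axis_def)

lemma vint_add: "vint (a + b) = vint a + vint b"
  by (simp add: vint_def vec_eq_iff)

lemma vint_axis: "vint (axis i 1) = axis i 1"
  by (simp add: vint_def axis_def vec_eq_iff)

lemma vint_eq_iff [simp]: "vint a = vint b \<longleftrightarrow> a = b"
  by (auto simp: vint_def vec_eq_iff)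

lemma vint_0 [simp]: "vint 0 = 0"
  by (simp add: vint_def vec_eq_iff)

lemma finite_box: "finite {m :: nat ^ 'n::finite. \<forall>i. m $ i \<le> N}"
proof -
  have "vec_nth ` {m :: nat ^ 'n. \<forall>i. m $ i \<le> N} \<subseteq> PiE UNIV (\<lambda>i. {..N})"
    by auto
  then have "finite (vec_nth ` {m :: nat ^ 'n. \<forall>i. m $ i \<le> N})"
    by (rule finite_subset) (intro finite_PiE; simp)
  then show ?thesis
    by (rule finite_imageD) (simp add: inj_on_def vec_nth_inject)
qed

lemma component_le_total: "m $ i \<le> total_degree m"
  unfolding total_degree_def by (rule member_le_sum) auto

lemma finite_total_le: "finite {m :: nat ^ 'n::finite. total_degree m \<le> N}"
  by (rule finite_subset [OF _ finite_box [of N]]) (use component_le_total order_trans in blast)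

lemma coeff_sum: "coeff (\<Sum>a\<in>A. f a) m = (\<Sum>a\<in>A. coeff (f a) m)"
  by (induction A rule: infinite_finite_induct) (simp_all add: zero_mps.rep_eq plus_mps.rep_eq)

lemma monom_0 [simp]: "monom 0 \<alpha> = 0"
  by (rule mps_eqI) (simp add: monom.rep_eq zero_mps.rep_eq)

text \<open>The convention for exponent vectors with a negative entry makes \<open>monom_mult\<close> fail outside the range of
  \<open>vint\<close>; there every monomial is \<open>0\<close>, and proofs distinguish the two cases.\<close>

lemma monom_eq_0: "\<alpha> \<notin> range vint \<Longrightarrow> monom c \<alpha> = 0"
  by (rule mps_eqI) (auto simp: monom.rep_eq zero_mps.rep_eq)

lemma monom_add: "monom a \<alpha> + monom b \<alpha> = monom (a + b) \<alpha>"
  by (rule mps_eqI) (simp add: monom.rep_eq plus_mps.rep_eq)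

lemma monom_mult: "monom a (vint m) * monom b (vint n) = monom (a * b) (vint (m + n))"
proof (rule mps_eqI)
  fix k
  have "coeff (monom a (vint m) * monom b (vint n)) k =
      (\<Sum>p\<in>{(x, y). x + y = k}. if p = (m, n) then a * b else 0)"
    unfolding times_mps.rep_eq by (rule sum.cong) (auto simp: monom.rep_eq split: if_splits)
  also have "\<dots> = coeff (monom (a * b) (vint (m + n))) k"
    by (subst sum.delta) (auto simp: finite_vec_sums monom.rep_eq)
  finally show "coeff (monom a (vint m) * monom b (vint n)) k = coeff (monom (a * b) (vint (m + n))) k" .
qed

lemma const_mult: "const a * const b = const (a * b)"
  using monom_mult [of a 0 b 0] by simp

lemma const_add: "const a + const b = const (a + b)"
  by (rule monom_add)

lemma const_mult_monom: "const a * monom b \<beta> = monom (a * b) \<beta>"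
proof (cases "\<beta> \<in> range vint")
  case True
  then obtain n where "\<beta> = vint n" by auto
  then show ?thesis using monom_mult [of a 0 b n] by simp
qed (simp add: monom_eq_0)

lemma const_of_nat: "const (of_nat k) = of_nat k"
  by (induction k) (simp_all add: const_1 flip: const_add)

lemma prod_X_power: "(\<Prod>i\<in>UNIV. X i ^ (n $ i)) = monom 1 (vint n)"
proof -
  have pow: "X i ^ k = monom 1 (vint (\<chi> j. if j = i then k else 0))" for i :: 'a and k
  proof (induction k)
    case 0
    have "(\<chi> j. if j = i then 0 else 0) = (0 :: nat ^ 'a)"
      by (simp add: vec_eq_iff)
    then show ?case by (simp add: const_1)
  next
    case (Suc k)
    have "axis i 1 + (\<chi> j. if j = i then k else 0) = (\<chi> j. if j = i then Suc k else (0::nat))"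
      by (simp add: vec_eq_iff axis_def)
    moreover have "X i = monom 1 (vint (axis i 1))"
      by (simp add: X_def vint_axis)
    ultimately show ?case
      unfolding power_Suc Suc.IH by (simp add: monom_mult)
  qed
  have "(\<Prod>i\<in>I. X i ^ (n $ i)) = monom 1 (vint (\<chi> j. if j \<in> I then n $ j else 0))" for I :: "'a set"
  proof (induction I rule: infinite_finite_induct)
    case empty
    have "(\<chi> j. 0) = (0 :: nat ^ 'a)"
      by (simp add: vec_eq_iff)
    then show ?case by (simp add: const_1)
  next
    case (insert i I)
    have "(\<chi> j. if j = i then n $ i else 0) + (\<chi> j. if j \<in> I then n $ j else 0) =
        (\<chi> j. if j \<in> insert i I then n $ j else 0)"
      using insert.hyps by (auto simp: vec_eq_iff)
    then show ?case
      using insert by (simp add: pow monom_mult)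
  qed simp
  from this [of UNIV] show ?thesis
    by simp
qed

lemma pd_add: "pd i (f + g) = pd i f + pd i g"
  by (rule mps_eqI) (simp add: pd.rep_eq plus_mps.rep_eq distrib_left)

lemma pd_0 [simp]: "pd i 0 = 0"
  by (rule mps_eqI) (simp add: pd.rep_eq zero_mps.rep_eq)

lemma pd_monom: "pd i (monom a \<alpha>) = monom (of_int (\<alpha> $ i) * a) (\<alpha> - axis i 1)"
proof (rule mps_eqI)
  fix m
  have "vint (m + axis i 1) = \<alpha> \<longleftrightarrow> vint m = \<alpha> - axis i 1"
    by (auto simp: vint_add vint_axis)
  moreover have "complex_of_nat (m $ i + 1) = of_int (\<alpha> $ i)" if "vint (m + axis i 1) = \<alpha>"
    unfolding that [symmetric] by (simp add: vint_def)
  ultimately show "coeff (pd i (monom a \<alpha>)) m = coeff (monom (of_int (\<alpha> $ i) * a) (\<alpha> - axis i 1)) m"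
    by (auto simp: pd.rep_eq monom.rep_eq simp del: of_nat_add)
qed

lemma pd_const [simp]: "pd i (const c) = 0"
  by (simp add: pd_monom)

text \<open>The factor \<open>a\<^sub>i\<close> removes the pairs with \<open>a\<^sub>i = 0\<close>, which are those not reached by adding \<open>e\<^sub>i\<close>
  to the first component.\<close>

lemma shift_vec_sums:
  "(\<Sum>(a, b)\<in>{(a, b). a + b = m}. of_nat (a $ i + 1) * h (a + axis i 1) b) =
    (\<Sum>(a, b)\<in>{(a, b). a + b = m + axis i 1}. of_nat (a $ i) * h a (b :: nat ^ 'n) :: complex)"
proof -
  have "(\<Sum>(a, b)\<in>{(a, b). a + b = m}. of_nat (a $ i + 1) * h (a + axis i 1) b) =
      (\<Sum>(a, b)\<in>{(a, b). a + b = m + axis i 1 \<and> a $ i \<noteq> 0}. of_nat (a $ i) * h a b)"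
  proof (rule sum.reindex_bij_witness [of _ "\<lambda>(a, b). (a - axis i 1, b)" "\<lambda>(a, b). (a + axis i 1, b)"],
      goal_cases)
    case (4 p)
    then obtain a b where p: "p = (a, b)" and ab: "a + b = m + axis i 1" "a $ i \<noteq> 0"
      by auto
    have "(a - axis i 1) $ j + b $ j = m $ j" for j
      using arg_cong [OF ab(1), of "\<lambda>v. v $ j"] ab(2) by (cases "j = i") (auto simp: axis_def)
    then show ?case
      by (simp add: p vec_eq_iff)
  next
    case (3 p)
    then show ?case
      by (auto simp: vec_eq_iff axis_def)
  qed (auto simp: axis_def ac_simps)
  also have "\<dots> = (\<Sum>(a, b)\<in>{(a, b). a + b = m + axis i 1}. of_nat (a $ i) * h a b)"
    by (rule sum.mono_neutral_left) (auto simp: finite_vec_sums)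
  finally show ?thesis .
qed

text \<open>The Leibniz rule: in the coefficient of \<open>x\<^sup>m\<close> the factor \<open>m\<^sub>i + 1\<close> is the sum of the exponents of
  \<open>x\<^sub>i\<close> in the two factors, which splits the sum into the two products.\<close>

lemma pd_mult: "pd i (f * g) = pd i f * g + f * pd i g"
proof (rule mps_eqI)
  fix m
  let ?P = "\<lambda>m. {(a, b). a + b = m}"
  have "coeff (f * pd i g) m = coeff (pd i g * f) m"
    by (simp add: mult.commute)
  also have "\<dots> = (\<Sum>(b, a)\<in>?P (m + axis i 1). of_nat (b $ i) * (coeff f a * coeff g b))"
    unfolding times_mps.rep_eq pd.rep_eq
    using shift_vec_sums [of i "\<lambda>b a. coeff f a * coeff g b" m] by (simp add: ac_simps)
  also have "\<dots> = (\<Sum>(a, b)\<in>?P (m + axis i 1). of_nat (b $ i) * (coeff f a * coeff g b))"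
    by (rule sum.reindex_bij_witness [of _ "\<lambda>(a, b). (b, a)" "\<lambda>(a, b). (b, a)"])
      (auto simp: ac_simps)
  finally have right: "coeff (f * pd i g) m = \<dots>" .
  have left: "coeff (pd i f * g) m =
      (\<Sum>(a, b)\<in>?P (m + axis i 1). of_nat (a $ i) * (coeff f a * coeff g b))"
    unfolding times_mps.rep_eq pd.rep_eq
    using shift_vec_sums [of i "\<lambda>a b. coeff f a * coeff g b" m] by (simp add: ac_simps)
  have m_i: "of_nat (m $ i + 1) = (of_nat (a $ i) + of_nat (b $ i) :: complex)"
    if "a + b = m + axis i 1" for a b
    using arg_cong [OF that, of "\<lambda>v. v $ i"] by (simp add: axis_def flip: of_nat_add)
  have "coeff (pd i (f * g)) m =
      (\<Sum>(a, b)\<in>?P (m + axis i 1). of_nat (m $ i + 1) * (coeff f a * coeff g b))"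
    unfolding pd.rep_eq times_mps.rep_eq sum_distrib_left split_def ..
  also have "\<dots> = (\<Sum>(a, b)\<in>?P (m + axis i 1).
      (of_nat (a $ i) + of_nat (b $ i)) * (coeff f a * coeff g b))"
  proof (rule sum.cong [OF refl])
    fix p assume "p \<in> ?P (m + axis i 1)"
    then obtain a b where p: "p = (a, b)" and ab: "a + b = m + axis i 1"
      by auto
    show "(case p of (a, b) \<Rightarrow> of_nat (m $ i + 1) * (coeff f a * coeff g b)) =
        (case p of (a, b) \<Rightarrow> (of_nat (a $ i) + of_nat (b $ i)) * (coeff f a * coeff g b))"
      unfolding p prod.case m_i [OF ab] ..
  qed
  also have "\<dots> = coeff (pd i f * g + f * pd i g) m"
    by (simp add: plus_mps.rep_eq left right distrib_right sum.distrib split_def)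
  finally show "coeff (pd i (f * g)) m = coeff (pd i f * g + f * pd i g) m" .
qed

section \<open>Order of vanishing\<close>

definition vanishes :: "nat \<Rightarrow> 'n::finite mps \<Rightarrow> bool" where
  "vanishes N f \<longleftrightarrow> (\<forall>m. total_degree m < N \<longrightarrow> coeff f m = 0)"

lemma vanishes_0 [simp]: "vanishes N 0"
  by (simp add: vanishes_def zero_mps.rep_eq)

lemma vanishes_0_left [simp]: "vanishes 0 f"
  by (simp add: vanishes_def)

lemma vanishes_mono: "vanishes N f \<Longrightarrow> M \<le> N \<Longrightarrow> vanishes M f"
  by (auto simp: vanishes_def)

lemma vanishes_add: "vanishes N f \<Longrightarrow> vanishes N g \<Longrightarrow> vanishes N (f + g)"
  by (simp add: vanishes_def plus_mps.rep_eq)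

lemma vanishes_minus: "vanishes N (- f) \<longleftrightarrow> vanishes N f"
  by (simp add: vanishes_def uminus_mps.rep_eq)

lemma vanishes_sum: "(\<And>a. a \<in> A \<Longrightarrow> vanishes N (f a)) \<Longrightarrow> vanishes N (\<Sum>a\<in>A. f a)"
  by (simp add: vanishes_def coeff_sum)

lemma vanishes_mult:
  fixes f g :: "'n::finite mps"
  assumes "vanishes M f" "vanishes N g"
  shows "vanishes (M + N) (f * g)"
  unfolding vanishes_def times_mps.rep_eq
proof (intro allI impI sum.neutral ballI)
  fix m :: "nat ^ 'n" and p
  assume m: "total_degree m < M + N" and "p \<in> {(a, b). a + b = m}"
  then obtain a b where p: "p = (a, b)" "a + b = m"
    by auto
  then have "total_degree a < M \<or> total_degree b < N"
    using m total_degree_add [of a b] by auto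
  with assms show "(case p of (a, b) \<Rightarrow> coeff f a * coeff g b) = 0"
    by (auto simp: p vanishes_def)
qed

lemma vanishes_mult_right: "vanishes N g \<Longrightarrow> vanishes N (f * g)"
  using vanishes_mult [of 0 f N g] by simp

lemma vanishes_mult_left: "vanishes N f \<Longrightarrow> vanishes N (f * g)"
  using vanishes_mult [of N f 0 g] by simp

lemma vanishes_prod:
  assumes "finite I" "\<And>i. i \<in> I \<Longrightarrow> vanishes (k i) (f i)"
  shows "vanishes (\<Sum>i\<in>I. k i) (\<Prod>i\<in>I. f i)"
  using assms by (induction I) (auto intro: vanishes_mult)

lemma vanishes_power: "vanishes 1 f \<Longrightarrow> vanishes n (f ^ n)"
proof (induction n)
  case (Suc n)
  then show ?case
    using vanishes_mult [of 1 f n "f ^ n"] by (simp add: plus_1_eq_Suc)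
qed simp

lemma vanishes_monom: "nat (deg \<alpha>) \<ge> N \<Longrightarrow> vanishes N (monom a \<alpha>)"
  by (auto simp: vanishes_def monom.rep_eq)

lemma vanishes_pd: "vanishes N f \<Longrightarrow> vanishes (N - 1) (pd i f)"
  by (simp add: vanishes_def pd.rep_eq total_degree_add less_diff_conv)

definition cong_mod :: "nat \<Rightarrow> 'n::finite mps \<Rightarrow> 'n mps \<Rightarrow> bool" where
  "cong_mod N f g \<longleftrightarrow> vanishes N (f - g)"

lemma cong_mod_iff: "cong_mod N f g \<longleftrightarrow> (\<forall>m. total_degree m < N \<longrightarrow> coeff f m = coeff g m)"
  by (simp add: cong_mod_def vanishes_def minus_mps.rep_eq)

lemma cong_mod_sym: "cong_mod N f g \<Longrightarrow> cong_mod N g f"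
  by (simp add: cong_mod_iff)

lemma cong_mod_trans [trans]: "cong_mod N f g \<Longrightarrow> cong_mod N g h \<Longrightarrow> cong_mod N f h"
  by (simp add: cong_mod_iff)

lemma cong_mod_add:
  "cong_mod N f f' \<Longrightarrow> cong_mod N g g' \<Longrightarrow> cong_mod N (f + g) (f' + g')"
  by (simp add: cong_mod_iff plus_mps.rep_eq)

lemma cong_mod_mult:
  assumes "cong_mod N f f'" "cong_mod N g g'"
  shows "cong_mod N (f * g) (f' * g')"
proof -
  have "f * g - f' * g' = (f - f') * g + f' * (g - g')"
    by (simp add: algebra_simps)
  then show ?thesis
    using assms unfolding cong_mod_def
    by (simp add: vanishes_add vanishes_mult_left vanishes_mult_right)
qed

lemma eq_if_cong_mod: "(\<And>N. cong_mod (Suc N) f g) \<Longrightarrow> f = g"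
  unfolding cong_mod_iff by (meson lessI mps_eqI)

text \<open>Identities between infinite sums of series are proved modulo each order, for the finite sums of the
  terms that are visible there.\<close>

lemma cong_mod_formal_sum:
  assumes "A' \<subseteq> A" "finite A'" and van: "\<And>a. a \<in> A - A' \<Longrightarrow> vanishes N (f a)"
  shows "cong_mod N (formal_sum f A) (\<Sum>a\<in>A'. f a)"
  unfolding cong_mod_iff
proof (intro allI impI)
  fix m :: "nat ^ 'b"
  assume m: "total_degree m < N"
  have "coeff (formal_sum f A) m = (\<Sum>a\<in>{a \<in> A. coeff (f a) m \<noteq> 0}. coeff (f a) m)"
    by (simp add: formal_sum.rep_eq)
  also have "\<dots> = (\<Sum>a\<in>A'. coeff (f a) m)"
    using van m assms(1,2) unfolding vanishes_def by (intro sum.mono_neutral_left) auto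
  finally show "coeff (formal_sum f A) m = coeff (\<Sum>a\<in>A'. f a) m"
    by (simp add: coeff_sum)
qed

section \<open>Substitution operators\<close>

lemma coeff_diffeo:
  "coeff (diffeo p i) m =
    (if total_degree m < 2 then coeff (X i) m else p i (vint m - axis i 1))"
proof -
  have H_iff: "vint m - axis i 1 \<in> H_comp i \<longleftrightarrow> 2 \<le> total_degree m"
    unfolding H_comp_def by auto
  let ?c = "\<lambda>\<eta>. coeff (monom (p i \<eta>) (\<eta> + axis i 1)) m"
  have c: "?c \<eta> = (if \<eta> = vint m - axis i 1 then p i (vint m - axis i 1) else 0)" for \<eta>
    by (auto simp: monom.rep_eq)
  have "coeff (formal_sum (\<lambda>\<eta>. monom (p i \<eta>) (\<eta> + axis i 1)) (H_comp i)) m =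
      (\<Sum>\<eta>\<in>{\<eta> \<in> H_comp i. ?c \<eta> \<noteq> 0}. ?c \<eta>)"
    by (simp add: formal_sum.rep_eq)
  also have "\<dots> = (\<Sum>\<eta>\<in>(if 2 \<le> total_degree m then {vint m - axis i 1} else {}). ?c \<eta>)"
    by (rule sum.mono_neutral_left) (auto simp: c H_iff split: if_splits)
  also have "\<dots> = (if total_degree m < 2 then 0 else p i (vint m - axis i 1))"
    by (simp add: c)
  finally have *: "coeff (formal_sum (\<lambda>\<eta>. monom (p i \<eta>) (\<eta> + axis i 1)) (H_comp i)) m = \<dots>" .
  have "coeff (X i) m = 0" if "2 \<le> total_degree m"
    using that unfolding X_def monom.rep_eq vint_axis [symmetric] by auto
  with * show ?thesis
    by (auto simp: diffeo_def plus_mps.rep_eq)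
qed

text \<open>The exponents \<open>\<eta> + e\<^sub>i\<close> with \<open>\<eta> \<in> H_comp i\<close> are exactly those of total degree at least \<open>2\<close>, so being tangent
  to the identity is the only restriction.\<close>

lemma in_G_iff: "\<phi> \<in> G \<longleftrightarrow> (\<forall>i. cong_mod 2 (\<phi> i) (X i))"
proof
  assume "\<phi> \<in> G"
  then show "\<forall>i. cong_mod 2 (\<phi> i) (X i)"
    by (auto simp: G_def cong_mod_iff coeff_diffeo)
next
  assume *: "\<forall>i. cong_mod 2 (\<phi> i) (X i)"
  have "\<phi> = diffeo (\<lambda>i \<eta>. coeff (\<phi> i) (inv vint (\<eta> + axis i 1)))"
  proof (intro ext mps_eqI)
    fix i m
    have "inv vint (vint m :: int ^ 'a) = m"
      by (rule inv_f_f) (simp add: inj_def)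
    then show "coeff (\<phi> i) m = coeff (diffeo (\<lambda>i \<eta>. coeff (\<phi> i) (inv vint (\<eta> + axis i 1))) i) m"
      using * by (simp add: coeff_diffeo cong_mod_iff)
  qed
  then show "\<phi> \<in> G"
    unfolding G_def by blast
qed

lemma vanishes_X: "vanishes 1 (X i)"
  unfolding X_def by (rule vanishes_monom) simp

lemma cong_mod_Theta:
  assumes "\<phi> \<in> G"
  shows "cong_mod (Suc N) (Theta \<phi> g)
    (\<Sum>n\<in>{n. total_degree n \<le> N}. const (coeff g n) * (\<Prod>i\<in>UNIV. \<phi> i ^ (n $ i)))"
  unfolding Theta_def
proof (rule cong_mod_formal_sum)
  fix n :: "nat ^ 'a"
  assume "n \<in> UNIV - {n. total_degree n \<le> N}"
  have "vanishes 1 (\<phi> i)" for i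
  proof -
    have "cong_mod 2 (\<phi> i) (X i)"
      using assms by (simp add: in_G_iff)
    then show ?thesis
      using vanishes_X [of i] by (auto simp: vanishes_def cong_mod_iff)
  qed
  then have "vanishes (total_degree n) (\<Prod>i\<in>UNIV. \<phi> i ^ (n $ i))"
    unfolding total_degree_def by (intro vanishes_prod vanishes_power) auto
  then show "vanishes (Suc N) (const (coeff g n) * (\<Prod>i\<in>UNIV. \<phi> i ^ (n $ i)))"
    using \<open>n \<in> _\<close> by (intro vanishes_mult_right) (auto elim: vanishes_mono)
qed (auto simp: finite_total_le)

lemma truncation_cong_mod: 
  "cong_mod (Suc N) g (\<Sum>n\<in>{n. total_degree n \<le> N}. const (coeff g n) * (\<Prod>i\<in>UNIV. X i ^ (n $ i)))"
  unfolding cong_mod_iff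
  by (simp add: coeff_sum prod_X_power const_mult_monom monom.rep_eq finite_total_le)

lemma Theta_X:
  fixes \<phi> :: "'n::finite \<Rightarrow> 'n mps"
  assumes "\<phi> \<in> G"
  shows "Theta \<phi> (X i) = \<phi> i"
proof (rule mps_eqI)
  fix m :: "nat ^ 'n"
  let ?N = "Suc (total_degree m)"
  have coeff_X: "coeff (X i) n = (if n = axis i 1 then 1 else 0)" for n
    unfolding X_def monom.rep_eq vint_axis [symmetric] by simp
  have "coeff (Theta \<phi> (X i)) m =
      coeff (\<Sum>n\<in>{n. total_degree n \<le> ?N}. const (coeff (X i) n) * (\<Prod>i\<in>UNIV. \<phi> i ^ (n $ i))) m"
    using cong_mod_Theta [OF assms, of ?N "X i"] by (simp add: cong_mod_iff)
  also have "\<dots> = coeff (\<Sum>n\<in>{n. total_degree n \<le> ?N}.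
      if n = axis i 1 then (\<Prod>j\<in>UNIV. \<phi> j ^ (n $ j)) else 0) m"
    by (intro arg_cong [where f = "\<lambda>h. coeff h m"] sum.cong) (simp_all add: coeff_X const_1)
  also have "\<dots> = coeff (\<Prod>j\<in>UNIV. \<phi> j ^ (axis i 1 $ j)) m"
    by (simp add: finite_total_le)
  also have "(\<Prod>j\<in>UNIV. \<phi> j ^ (axis i 1 $ j)) = (\<Prod>j\<in>UNIV. if j = i then \<phi> i else 1)"
    by (rule prod.cong) (auto simp: axis_def)
  finally show "coeff (Theta \<phi> (X i)) m = coeff (\<phi> i) m"
    by simp
qed

text \<open>A multiplicative linear operator that does not lower the order of a series is determined by
  the images of the coordinates: modulo any order a series is a polynomial.\<close>

lemma substitution_operator_eq_Theta:
  fixes L :: "'n::finite mps \<Rightarrow> 'n mps"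
  assumes add: "\<And>g h. L (g + h) = L g + L h"
    and mult: "\<And>g h. L (g * h) = L g * L h"
    and const: "\<And>c. L (const c) = const c"
    and cont: "\<And>N g. vanishes N g \<Longrightarrow> vanishes N (L g)"
    and G: "(\<lambda>i. L (X i)) \<in> G"
  shows "L = Theta (\<lambda>i. L (X i))"
proof (intro ext eq_if_cong_mod)
  fix g :: "'n mps" and N
  have L0: "L 0 = 0"
    using const [of 0] by simp
  have L1: "L 1 = 1"
    using const [of 1] by (simp only: const_1)
  have L_sum: "L (\<Sum>a\<in>A. f a) = (\<Sum>a\<in>A. L (f a))" for A :: "(nat ^ 'n) set" and f
    by (induction A rule: infinite_finite_induct) (simp_all add: add L0)
  have L_prod: "L (\<Prod>a\<in>A. f a) = (\<Prod>a\<in>A. L (f a))" for A :: "'n set" and f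
    by (induction A rule: infinite_finite_induct) (simp_all add: mult L1)
  have L_power: "L (h ^ k) = L h ^ k" for h and k
    by (induction k) (simp_all add: mult L1)
  have L_diff: "L (g - h) = L g - L h" for g h
    by (metis add add_diff_cancel diff_add_cancel)
  let ?p = "\<Sum>n\<in>{n. total_degree n \<le> N}. const (coeff g n) * (\<Prod>i\<in>UNIV. X i ^ (n $ i))"
  have "cong_mod (Suc N) (L g) (L ?p)"
    using cont [OF truncation_cong_mod [of N g, unfolded cong_mod_def]]
    by (simp add: cong_mod_def L_diff)
  also have "L ?p = (\<Sum>n\<in>{n. total_degree n \<le> N}. const (coeff g n) * (\<Prod>i\<in>UNIV. L (X i) ^ (n $ i)))"
    by (simp add: L_sum mult const L_prod L_power)
  also have "cong_mod (Suc N) \<dots> (Theta (\<lambda>i. L (X i)) g)"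
    by (rule cong_mod_sym [OF cong_mod_Theta [OF G]])
  finally show "cong_mod (Suc N) (L g) (Theta (\<lambda>i. L (X i)) g)" .
qed

section \<open>The Taylor shift\<close>

text \<open>\<open>shift_op v s\<close> is \<open>\<Sum> v\<^bsub>i\<^sub>1\<^esub> \<cdots> v\<^bsub>i\<^sub>s\<^esub> \<partial>\<^bsub>i\<^sub>1\<^esub> \<cdots> \<partial>\<^bsub>i\<^sub>s\<^esub>\<close>, the normally ordered \<open>s\<close>-th
  power of the vector field with components \<open>v\<close>.\<close>

primrec shift_op :: "('n \<Rightarrow> 'n mps) \<Rightarrow> nat \<Rightarrow> 'n::finite mps \<Rightarrow> 'n mps" where
  "shift_op v 0 g = g"
| "shift_op v (Suc s) g = (\<Sum>i\<in>UNIV. v i * shift_op v s (pd i g))"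

lemma shift_op_add: "shift_op v s (g + h) = shift_op v s g + shift_op v s h"
  by (induction s arbitrary: g h) (simp_all add: pd_add distrib_left sum.distrib)

lemma shift_op_0 [simp]: "shift_op v s 0 = 0"
  by (induction s) simp_all

text \<open>The step \<open>s \<rightarrow> s + 1\<close> of a binomial formula, as Pascal's rule for an arbitrary array of terms.\<close>

lemma pascal_sum:
  fixes a :: "nat \<Rightarrow> nat \<Rightarrow> 'b::comm_semiring_1"
  shows "(\<Sum>k\<le>s. of_nat (s choose k) * (a (Suc k) (s - k) + a k (Suc (s - k)))) =
    (\<Sum>k\<le>Suc s. of_nat (Suc s choose k) * a k (Suc s - k))"
proof -
  have "(\<Sum>k\<le>s. of_nat (s choose k) * a k (Suc (s - k))) =
      a 0 (Suc s) + (\<Sum>k<s. of_nat (s choose Suc k) * a (Suc k) (Suc (s - Suc k)))"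
    by (subst sum.atMost_shift) simp
  also have "(\<Sum>k<s. of_nat (s choose Suc k) * a (Suc k) (Suc (s - Suc k))) =
      (\<Sum>k\<le>s. of_nat (s choose Suc k) * a (Suc k) (s - k))"
    by (rule sum.mono_neutral_cong_left) (auto simp: Suc_diff_Suc le_less binomial_eq_0)
  finally have *: "(\<Sum>k\<le>s. of_nat (s choose k) * a k (Suc (s - k))) =
      a 0 (Suc s) + (\<Sum>k\<le>s. of_nat (s choose Suc k) * a (Suc k) (s - k))" .
  show ?thesis
    by (subst sum.atMost_Suc_shift) (simp add: distrib_left distrib_right sum.distrib * ac_simps)
qed

lemma shift_op_mult:
  "shift_op v s (g * h) =
    (\<Sum>k\<le>s. of_nat (s choose k) * (shift_op v k g * shift_op v (s - k) h))"
proof (induction s arbitrary: g h)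
  case (Suc s)
  have "shift_op v (Suc s) (g * h) =
      (\<Sum>i\<in>UNIV. \<Sum>k\<le>s. of_nat (s choose k) *
        (v i * shift_op v k (pd i g) * shift_op v (s - k) h +
         shift_op v k g * (v i * shift_op v (s - k) (pd i h))))"
    unfolding shift_op.simps pd_mult shift_op_add Suc.IH
    by (simp add: sum_distrib_left sum.distrib distrib_left ac_simps)
  also have "\<dots> = (\<Sum>k\<le>s. of_nat (s choose k) *
      (shift_op v (Suc k) g * shift_op v (s - k) h + shift_op v k g * shift_op v (Suc (s - k)) h))"
    by (subst sum.swap) (simp add: sum_distrib_left sum_distrib_right sum.distrib distrib_left ac_simps)
  also have "\<dots> = (\<Sum>k\<le>Suc s. of_nat (Suc s choose k) *
      (shift_op v k g * shift_op v (Suc s - k) h))"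
    by (rule pascal_sum)
  finally show ?case .
qed simp

text \<open>A derivative loses one order and multiplication by a component of \<open>v\<close> gains two.\<close>

lemma vanishes_shift_op:
  assumes v: "\<And>i. vanishes 2 (v i)"
  shows "vanishes n g \<Longrightarrow> vanishes (n + s) (shift_op v s g)"
proof (induction s arbitrary: n g)
  case (Suc s)
  have "vanishes (2 + (n - 1 + s)) (v i * shift_op v s (pd i g))" for i
    by (intro vanishes_mult v Suc.IH vanishes_pd Suc.prems)
  then have "vanishes (n + Suc s) (v i * shift_op v s (pd i g))" for i
    by (rule vanishes_mono) simp
  then show ?case
    by (auto intro: vanishes_sum)
qed simp

text \<open>The Taylor expansion of \<open>g (x + v x)\<close>, truncated at order \<open>N\<close>.\<close>

definition taylor :: "('n \<Rightarrow> 'n mps) \<Rightarrow> nat \<Rightarrow> 'n::finite mps \<Rightarrow> 'n mps" where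
  "taylor v N g = (\<Sum>s\<le>N. const (1 / fact s) * shift_op v s g)"

lemma taylor_add: "taylor v N (g + h) = taylor v N g + taylor v N h"
  by (simp add: taylor_def shift_op_add distrib_left sum.distrib)

lemma taylor_const: "taylor v N (const c) = const c"
  unfolding taylor_def by (subst sum.atMost_shift) (simp add: const_1)

text \<open>The Taylor shift by \<open>v\<close> maps \<open>x\<^sub>i\<close> to \<open>x\<^sub>i + v\<^sub>i\<close>: a second derivative kills a coordinate.\<close>

lemma taylor_X:
  assumes "N \<ge> 1"
  shows "taylor v N (X i) = X i + v i"
proof -
  from assms obtain M where N: "N = Suc M"
    by (cases N) auto
  have one: "shift_op v s 1 = (if s = 0 then 1 else 0)" for s
    by (cases s) (simp_all flip: const_1)
  have "shift_op v (Suc s) (X i) = (if s = 0 then v i else 0)" for s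
  proof -
    have "shift_op v (Suc s) (X i) = (\<Sum>j\<in>UNIV. if j = i then v i * shift_op v s 1 else 0)"
      unfolding shift_op.simps by (rule sum.cong) (auto simp: pd_X)
    then show ?thesis
      by (simp add: one)
  qed
  then show ?thesis
    unfolding taylor_def N by (subst sum.atMost_Suc_shift)
      (simp add: const_1 if_distrib [of "(*) _"] cong: if_cong)
qed

lemma vanishes_taylor:
  assumes "\<And>i. vanishes 2 (v i)" "vanishes n g"
  shows "vanishes n (taylor v N g)"
  unfolding taylor_def
  by (intro vanishes_sum vanishes_mult_right vanishes_mono [OF vanishes_shift_op [of v, OF assms]]) simp

text \<open>Normally ordered exponentials of vector fields are multiplicative: in the divided powers
  \<open>shift_op v s / s!\<close> the binomial coefficients of the Leibniz rule disappear, and the terms of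
  the product that are not in the truncated series have high order.\<close>

lemma taylor_mult:
  assumes v: "\<And>i. vanishes 2 (v i)"
  shows "cong_mod (Suc N) (taylor v N (g * h :: 'a::finite mps)) (taylor v N g * taylor v N h)"
proof -
  define E where "E = (\<lambda>s g. const (1 / fact s) * shift_op v s g)"
  have E_mult: "E s (g * h) = (\<Sum>k\<le>s. E k g * E (s - k) h)" for s
  proof -
    have "const (1 / fact s) * (of_nat (s choose k) * (g' * h')) =
        const (1 / fact k) * g' * (const (1 / fact (s - k)) * h')" if "k \<le> s" for k and g' h' :: "'a mps"
    proof -
      have "1 / fact s * of_nat (s choose k) = (1 / fact k * (1 / fact (s - k)) :: complex)"
        using binomial_fact [OF that, where 'a = complex] by (simp add: field_simps)
      then have "const (1 / fact s) * of_nat (s choose k) =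
          (const (1 / fact k) * const (1 / fact (s - k)) :: 'a mps)"
        by (simp only: const_mult flip: const_of_nat)
      then have "const (1 / fact s) * of_nat (s choose k) * (g' * h') =
          const (1 / fact k) * const (1 / fact (s - k)) * (g' * h')"
        by simp
      then show ?thesis
        by (simp only: ac_simps)
    qed
    then show ?thesis
      unfolding E_def shift_op_mult sum_distrib_left
      by (intro sum.cong refl) simp
  qed
  have E_van: "vanishes s (E s g)" for s g
    unfolding E_def using vanishes_shift_op [of v 0, OF v] by (simp add: vanishes_mult_right)
  have "taylor v N g * taylor v N h = (\<Sum>(k, l)\<in>{..N} \<times> {..N}. E k g * E l h)"
    by (simp add: taylor_def E_def sum_product sum.cartesian_product)
  also have "\<dots> = (\<Sum>(k, l)\<in>{(k, l). k + l \<le> N}. E k g * E l h) +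
      (\<Sum>(k, l)\<in>{..N} \<times> {..N} - {(k, l). k + l \<le> N}. E k g * E l h)"
    by (subst add.commute) (rule sum.subset_diff; auto)
  also have "(\<Sum>(k, l)\<in>{(k, l). k + l \<le> N}. E k g * E l h) = taylor v N (g * h)"
    unfolding sum.triangle_reindex_eq E_mult [symmetric] by (simp add: taylor_def E_def)
  finally have *: "taylor v N g * taylor v N h = taylor v N (g * h) +
      (\<Sum>(k, l)\<in>{..N} \<times> {..N} - {(k, l). k + l \<le> N}. E k g * E l h)" .
  have "vanishes (Suc N) (E k g * E l h)" if "\<not> k + l \<le> N" for k l
    using vanishes_mult [OF E_van [of k g] E_van [of l h]] that by (auto elim: vanishes_mono)
  then have "vanishes (Suc N)
      (\<Sum>(k, l)\<in>{..N} \<times> {..N} - {(k, l). k + l \<le> N}. E k g * E l h)"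
    by (intro vanishes_sum) auto
  then show ?thesis
    using * by (simp add: cong_mod_def vanishes_minus)
qed

section \<open>Sums over forests as sums over lists of trees\<close>

lemma sum_lists_Suc:
  assumes "finite S"
  shows "(\<Sum>xs | set xs \<subseteq> S \<and> length xs = Suc s. h xs) =
    (\<Sum>x\<in>S. \<Sum>xs | set xs \<subseteq> S \<and> length xs = s. h (x # xs))"
proof -
  have "(\<Sum>xs | set xs \<subseteq> S \<and> length xs = Suc s. h xs) =
      (\<Sum>(x, xs)\<in>S \<times> {xs. set xs \<subseteq> S \<and> length xs = s}. h (x # xs))"
    by (rule sum.reindex_bij_witness [of _ "\<lambda>(x, xs). x # xs" "\<lambda>xs. (hd xs, tl xs)"])
      (auto simp: length_Suc_conv)
  then show ?thesis
    by (simp add: sum.cartesian_product)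
qed

lemma finite_multisets_bounded:
  assumes "finite S"
  shows "finite {F. set_mset F \<subseteq> S \<and> size F \<le> N}"
proof -
  have "{F. set_mset F \<subseteq> S \<and> size F \<le> N} = mset ` {xs. set xs \<subseteq> S \<and> length xs \<le> N}"
    by (auto simp: image_iff) (metis ex_mset set_mset_mset size_mset)
  then show ?thesis
    using finite_lists_length_le [OF assms] by simp
qed

text \<open>Summing over all orderings of all multisets is summing over lists; products over lists then
  factor, which the multiplicities of a multiset would obstruct.\<close>

lemma sum_permutations_of_multisets:
  assumes "finite S"
  shows "(\<Sum>F | set_mset F \<subseteq> S \<and> size F = s. \<Sum>xs\<in>permutations_of_multiset F. h xs) =
    (\<Sum>xs | set xs \<subseteq> S \<and> length xs = s. h xs)"
proof -
  let ?L = "{xs. set xs \<subseteq> S \<and> length xs = s}" and ?M = "{F. set_mset F \<subseteq> S \<and> size F = s}"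
  have "finite ?M"
    by (rule finite_subset [OF _ finite_multisets_bounded [OF assms, of s]]) auto
  then have "(\<Sum>F\<in>?M. \<Sum>xs\<in>{xs \<in> ?L. mset xs = F}. h xs) = (\<Sum>xs\<in>?L. h xs)"
    by (intro sum.group finite_lists_length_eq assms) auto
  moreover have "{xs \<in> ?L. mset xs = F} = permutations_of_multiset F" if "F \<in> ?M" for F
    using that by (auto simp: permutations_of_multiset_def)
  ultimately show ?thesis
    by simp
qed

text \<open>The symmetry factor of a forest of \<open>s\<close> trees is the number of its enumerations, over \<open>s!\<close>.\<close>

lemma rho_eq_sum_permutations:
  "rho u F g = const (1 / fact (size F)) *
    (\<Sum>Ts\<in>permutations_of_multiset F. normal_product (map (rho_tree u) Ts) g)"
proof -
  obtain Ts where Ts: "mset Ts = F"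
    using ex_mset by blast
  let ?d = "\<Prod>T\<in>set_mset F. fact (count F T)" and ?k = "card (permutations_of_multiset F)"
  have "normal_product (map (rho_tree u) Us) = normal_product (map (rho_tree u) Ts)"
    if "Us \<in> permutations_of_multiset F" for Us
    using that Ts by (intro normal_product_cong) (auto simp: permutations_of_multiset_def)
  then have "(\<Sum>Us\<in>permutations_of_multiset F. normal_product (map (rho_tree u) Us) g) =
      const (of_nat ?k) * normal_product (map (rho_tree u) Ts) g"
    by (simp add: const_of_nat)
  moreover have "1 / fact (size F) * of_nat ?k = 1 / (?d :: complex)"
  proof -
    have "of_nat ?k * ?d = (fact (size F) :: complex)"
      using arg_cong [OF card_permutations_of_multiset_aux [of F], of "of_nat :: nat \<Rightarrow> complex"]
      by (simp add: of_nat_prod)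
    moreover have "?d \<noteq> (0 :: complex)"
      by simp
    ultimately show ?thesis
      by (simp add: field_simps)
  qed
  ultimately have "const (1 / fact (size F)) *
      (\<Sum>Us\<in>permutations_of_multiset F. normal_product (map (rho_tree u) Us) g) =
      const (1 / ?d) * normal_product (map (rho_tree u) Ts) g"
    by (simp only: mult.assoc [symmetric] const_mult)
  then show ?thesis
    using rho_mset [of u Ts g] Ts by auto
qed

text \<open>Normally ordered products are linear in each operator, so the sum over lists is the power of
  the vector field \<open>\<Sum> a\<^sub>T D\<^sub>T\<close>.\<close>

lemma sum_normal_product_eq_shift_op:
  assumes "finite S"
  shows "(\<Sum>Ts | set Ts \<subseteq> S \<and> length Ts = s.
      const (prod_list (map a Ts)) * normal_product (map D Ts) g) =
    shift_op (\<lambda>i. \<Sum>T\<in>S. const (a T) * D T (X i)) s g"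
proof (induction s arbitrary: g)
  case 0
  have "{Ts. set Ts \<subseteq> S \<and> length Ts = 0} = {[]}"
    by auto
  then show ?case
    by (simp add: normal_product_Nil const_1)
next
  case (Suc s)
  let ?L = "{Ts. set Ts \<subseteq> S \<and> length Ts = s}"
  let ?v = "\<lambda>i. \<Sum>T\<in>S. const (a T) * D T (X i)"
  have "(\<Sum>Ts | set Ts \<subseteq> S \<and> length Ts = Suc s.
      const (prod_list (map a Ts)) * normal_product (map D Ts) g) =
      (\<Sum>T\<in>S. \<Sum>Ts\<in>?L. \<Sum>i\<in>UNIV. const (a T) * D T (X i) *
        (const (prod_list (map a Ts)) * normal_product (map D Ts) (pd i g)))"
    by (simp add: sum_lists_Suc [OF assms] normal_product_Cons sum_distrib_left ac_simps
        flip: const_mult)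
  also have "\<dots> = (\<Sum>T\<in>S. \<Sum>i\<in>UNIV. \<Sum>Ts\<in>?L. const (a T) * D T (X i) *
        (const (prod_list (map a Ts)) * normal_product (map D Ts) (pd i g)))"
    by (intro sum.cong refl sum.swap)
  also have "\<dots> = (\<Sum>i\<in>UNIV. \<Sum>T\<in>S. const (a T) * D T (X i) * shift_op ?v s (pd i g))"
    by (subst sum.swap) (simp only: Suc.IH sum_distrib_left [symmetric])
  also have "\<dots> = shift_op ?v (Suc s) g"
    by (simp add: sum_distrib_right)
  finally show ?case .
qed

text \<open>A multiplicative family of coefficients turns the sum over all forests into an
  exponential series, whose vector field is the sum over the trees.\<close>

lemma sum_forests_eq_taylor:
  assumes "finite S"
  shows "(\<Sum>F | set_mset F \<subseteq> S \<and> size F \<le> N. const (\<Prod>T\<in>#F. a T) * rho u F g) =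
    taylor (\<lambda>i. \<Sum>T\<in>S. const (a T) * rho_tree u T (X i)) N g"
proof -
  let ?v = "\<lambda>i. \<Sum>T\<in>S. const (a T) * rho_tree u T (X i)"
  let ?M = "\<lambda>s. {F. set_mset F \<subseteq> S \<and> size F = s}"
  have "(\<Sum>F\<in>?M s. const (\<Prod>T\<in>#F. a T) * rho u F g) = const (1 / fact s) * shift_op ?v s g" for s
  proof -
    have "(\<Sum>F\<in>?M s. const (\<Prod>T\<in>#F. a T) * rho u F g) =
        (\<Sum>F\<in>?M s. const (1 / fact s) * (\<Sum>Ts\<in>permutations_of_multiset F.
          const (prod_list (map a Ts)) * normal_product (map (rho_tree u) Ts) g))"
    proof (intro sum.cong refl)
      fix F assume "F \<in> ?M s"
      moreover have "prod_list (map a Ts) = (\<Prod>T\<in>#F. a T)" if "Ts \<in> permutations_of_multiset F" for Ts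
        using that by (auto simp: permutations_of_multiset_def prod_mset_prod_list [symmetric])
      ultimately show "const (\<Prod>T\<in>#F. a T) * rho u F g =
          const (1 / fact s) * (\<Sum>Ts\<in>permutations_of_multiset F.
            const (prod_list (map a Ts)) * normal_product (map (rho_tree u) Ts) g)"
        by (simp add: rho_eq_sum_permutations sum_distrib_left ac_simps)
    qed
    then show ?thesis
      by (simp only: sum_distrib_left [symmetric] sum_permutations_of_multisets [OF assms]
          sum_normal_product_eq_shift_op [OF assms])
  qed
  moreover have "(\<Sum>F | set_mset F \<subseteq> S \<and> size F \<le> N. const (\<Prod>T\<in>#F. a T) * rho u F g) =
      (\<Sum>s\<le>N. \<Sum>F\<in>{F \<in> {F. set_mset F \<subseteq> S \<and> size F \<le> N}. size F = s}.
        const (\<Prod>T\<in>#F. a T) * rho u F g)"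
    by (rule sum.group [symmetric]) (auto simp: finite_multisets_bounded [OF assms])
  moreover have "{F \<in> {F. set_mset F \<subseteq> S \<and> size F \<le> N}. size F = s} = ?M s" if "s \<le> N" for s
    using that by auto
  ultimately show ?thesis
    by (simp add: taylor_def)
qed

section \<open>The monomial attached to a tree\<close>

primrec deco_prod :: "('a \<Rightarrow> real) \<Rightarrow> 'a rtree \<Rightarrow> real" where
  "deco_prod b (Node \<eta> F) = b \<eta> * prod_mset (image_mset (deco_prod b) F)"

text \<open>The factor collects the contributions that do not depend on the coefficients \<open>u\<close>.  At a vertex with
  decoration \<open>\<eta>\<close> and \<open>s\<close> subtrees, \<open>s\<close> derivatives act on a monomial of degree \<open>N = |\<eta>| + 1\<close> and give, summed over all
  choices of variables, \<open>N (N - 1) \<cdots> (N - s + 1) = s! (N choose s)\<close>; divided by the symmetry factor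
  this is \<open>N choose s\<close> times the number of orderings of the subtrees.\<close>

primrec tree_factor :: "(int ^ 'n::finite) rtree \<Rightarrow> real" where
  "tree_factor (Node \<eta> F) = real ((nat (deg \<eta>) + 1) choose size F) *
    real (card (permutations_of_multiset F)) * prod_mset (image_mset tree_factor F)"

lemma prod_mset_nonneg: "(\<And>x. x \<in># F \<Longrightarrow> 0 \<le> h x) \<Longrightarrow> 0 \<le> (\<Prod>x\<in>#F. h x :: real)"
  by (induction F) auto

lemma tree_factor_nonneg: "0 \<le> tree_factor T"
  by (induction T) (auto intro!: mult_nonneg_nonneg prod_mset_nonneg)

lemma deco_prod_nonneg: "(\<And>\<eta>. \<eta> \<in> set_rtree T \<Longrightarrow> 0 \<le> b \<eta>) \<Longrightarrow> 0 \<le> deco_prod b T"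
  by (induction T) (auto intro!: mult_nonneg_nonneg prod_mset_nonneg)

lemma deg_sum_mset: "deg (\<Sum>x\<in>#F. h x) = (\<Sum>x\<in>#F. deg (h x))"
  by (induction F) (simp_all add: deg_add)

lemma deg_weight: "deg (weight T) = gr_tree T"
proof (induction T)
  case (Node \<eta> F)
  then have "image_mset (\<lambda>T. deg (weight T)) F = image_mset gr_tree F"
    by (intro image_mset_cong) simp
  then show ?case
    by (simp add: deg_add deg_sum_mset)
qed

text \<open>A bound on a coefficient that is stable under sums of terms with one common exponent, and that
  \<open>0\<close> satisfies for every exponent.\<close>

definition monom_bounded :: "int ^ 'n \<Rightarrow> real \<Rightarrow> 'n::finite mps \<Rightarrow> bool" where
  "monom_bounded \<alpha> c f \<longleftrightarrow> (\<exists>a. f = monom a \<alpha> \<and> norm a \<le> c)"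

lemma monom_bounded_0: "0 \<le> c \<Longrightarrow> monom_bounded \<alpha> c 0"
  unfolding monom_bounded_def by (intro exI [of _ 0]) simp

lemma monom_bounded_mult:
  assumes "monom_bounded \<alpha> c f" "monom_bounded \<beta> d g"
  shows "monom_bounded (\<alpha> + \<beta>) (c * d) (f * g)"
proof -
  from assms obtain a b where f: "f = monom a \<alpha>" "norm a \<le> c" and g: "g = monom b \<beta>" "norm b \<le> d"
    by (auto simp: monom_bounded_def)
  have "0 \<le> c" "0 \<le> d"
    using f(2) g(2) norm_ge_zero order_trans by blast+
  show ?thesis
  proof (cases "\<alpha> \<in> range vint \<and> \<beta> \<in> range vint")
    case True
    then have "f * g = monom (a * b) (\<alpha> + \<beta>)"
      by (auto simp: f g monom_mult vint_add)
    moreover have "norm (a * b) \<le> c * d"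
      unfolding norm_mult using f(2) g(2) \<open>0 \<le> c\<close> by (intro mult_mono) auto
    ultimately show ?thesis
      by (auto simp: monom_bounded_def)
  next
    case False
    then have "f * g = 0"
      by (auto simp: f g monom_eq_0)
    then show ?thesis
      using \<open>0 \<le> c\<close> \<open>0 \<le> d\<close> by (simp add: monom_bounded_0)
  qed
qed

lemma monom_bounded_sum:
  assumes "\<And>i. i \<in> I \<Longrightarrow> monom_bounded \<alpha> (c i) (f i)"
  shows "monom_bounded \<alpha> (\<Sum>i\<in>I. c i) (\<Sum>i\<in>I. f i)"
  using assms
proof (induction I rule: infinite_finite_induct)
  case (insert i I)
  have "monom_bounded \<alpha> (c i) (f i)" "monom_bounded \<alpha> (\<Sum>i\<in>I. c i) (\<Sum>i\<in>I. f i)"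
    by (simp_all add: insert)
  then obtain a b where "f i = monom a \<alpha>" "norm a \<le> c i" "(\<Sum>i\<in>I. f i) = monom b \<alpha>"
      "norm b \<le> (\<Sum>i\<in>I. c i)"
    unfolding monom_bounded_def by blast
  then show ?case
    using insert.hyps norm_triangle_mono [of a "c i" b] by (auto simp: monom_bounded_def monom_add)
qed (simp_all add: monom_bounded_0)

lemma normal_product_0 [simp]: "normal_product Ds 0 = 0"
  by (induction Ds) (simp_all add: normal_product_Nil normal_product_Cons)

text \<open>The sum over the variables of all first derivatives of a monomial of degree \<open>N\<close> has coefficients of
  sum \<open>N\<close>, because these are the exponents; iterating gives the falling factorial of \<open>N\<close>.\<close>

lemma normal_product_monom_bounded:
  assumes "\<And>T i. T \<in> set Ts \<Longrightarrow> monom_bounded (w T + axis i 1) (M T) (D T (X i))"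
    and "\<And>T. T \<in> set Ts \<Longrightarrow> 0 \<le> M T"
  shows "monom_bounded (vint n + sum_list (map w Ts))
    (norm a * (fact (length Ts) * real (total_degree n choose length Ts)) * prod_list (map M Ts))
    (normal_product (map D Ts) (monom a (vint n)))"
  using assms
proof (induction Ts arbitrary: a n)
  case Nil
  then show ?case
    by (auto simp: normal_product_Nil monom_bounded_def)
next
  case (Cons T Ts)
  let ?s = "length Ts" and ?P = "prod_list (map M Ts)"
  let ?c = "\<lambda>i. M T * (real (n $ i) * norm a * (fact ?s * real ((total_degree n - 1) choose ?s)) * ?P)"
  have P: "0 \<le> ?P"
    using Cons.prems(2) by (intro prod_list_nonneg) auto
  have "monom_bounded (vint n + sum_list (map w (T # Ts))) (?c i)
      (D T (X i) * normal_product (map D Ts) (pd i (monom a (vint n))))" for i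
  proof (cases "n $ i = 0")
    case True
    then have "pd i (monom a (vint n)) = 0"
      by (simp add: pd_monom vint_def)
    then show ?thesis
      using True by (simp add: monom_bounded_0)
  next
    case False
    define m where "m = n - axis i 1"
    have n: "n = m + axis i 1"
      using False by (auto simp: m_def vec_eq_iff axis_def)
    then have "total_degree m = total_degree n - 1"
      by (simp add: total_degree_add)
    \<comment> \<open>The derivative multiplies the coefficient by the exponent and lowers the degree by one.\<close>
    then have "monom_bounded (vint m + sum_list (map w Ts))
        (norm (of_nat (n $ i) * a) * (fact ?s * real ((total_degree n - 1) choose ?s)) * ?P)
        (normal_product (map D Ts) (monom (of_nat (n $ i) * a) (vint m)))"
      using Cons.IH [of m "of_nat (n $ i) * a"] Cons.prems by simp
    from monom_bounded_mult [OF Cons.prems(1) this, of T i]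
    have "monom_bounded (w T + axis i 1 + (vint m + sum_list (map w Ts))) (?c i)
        (D T (X i) * normal_product (map D Ts) (monom (of_nat (n $ i) * a) (vint m)))"
      by (simp add: norm_mult)
    moreover have "pd i (monom a (vint n)) = monom (of_nat (n $ i) * a) (vint m)"
      by (simp add: pd_monom) (simp add: n vint_add vint_axis, simp add: vint_def)
    ultimately show ?thesis
      by (simp add: n vint_add vint_axis ac_simps)
  qed
  then have "monom_bounded (vint n + sum_list (map w (T # Ts))) (\<Sum>i\<in>UNIV. ?c i)
      (normal_product (map D (T # Ts)) (monom a (vint n)))"
    unfolding list.map normal_product_Cons by (intro monom_bounded_sum) simp
  moreover have "(\<Sum>i\<in>UNIV. ?c i) =
      norm a * (fact (Suc ?s) * real (total_degree n choose Suc ?s)) * prod_list (map M (T # Ts))"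
  proof -
    have "(\<Sum>i\<in>UNIV. ?c i) =
        real (total_degree n) * real ((total_degree n - 1) choose ?s) * (M T * norm a * fact ?s * ?P)"
      by (simp add: total_degree_def sum_distrib_left sum_distrib_right ac_simps)
    also have "real (total_degree n) * real ((total_degree n - 1) choose ?s) =
        real (Suc ?s) * real (total_degree n choose Suc ?s)"
      using binomial_absorption [of ?s "total_degree n"] by (simp only: flip: of_nat_mult)
    finally show ?thesis
      by (simp add: ac_simps)
  qed
  ultimately show ?case
    by simp
qed

lemma rho_monom_bounded:
  assumes "\<And>T i. T \<in># F \<Longrightarrow> monom_bounded (weight T + axis i 1) (M T) (rho_tree u T (X i))"
    and "\<And>T. T \<in># F \<Longrightarrow> 0 \<le> M T"
  shows "monom_bounded (vint n + (\<Sum>T\<in>#F. weight T))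
    (norm a * (real (total_degree n choose size F) * real (card (permutations_of_multiset F))) *
      (\<Prod>T\<in>#F. M T))
    (rho u F (monom a (vint n)))"
proof -
  let ?c = "norm a * (fact (size F) * real (total_degree n choose size F)) * (\<Prod>T\<in>#F. M T)"
  have "monom_bounded (vint n + (\<Sum>T\<in>#F. weight T)) ?c
      (normal_product (map (rho_tree u) Ts) (monom a (vint n)))"
    if "Ts \<in> permutations_of_multiset F" for Ts
  proof -
    have F: "F = mset Ts"
      using that by (simp add: permutations_of_multiset_def)
    show ?thesis
      using normal_product_monom_bounded [of Ts weight M "rho_tree u" n a] assms
      by (simp add: F prod_mset_prod_list [symmetric] sum_mset_sum_list [symmetric])
  qed
  then have "monom_bounded (vint n + (\<Sum>T\<in>#F. weight T)) (\<Sum>Ts\<in>permutations_of_multiset F. ?c)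
      (\<Sum>Ts\<in>permutations_of_multiset F. normal_product (map (rho_tree u) Ts) (monom a (vint n)))"
    by (rule monom_bounded_sum)
  moreover have "monom_bounded 0 (1 / fact (size F)) (const (1 / fact (size F)))"
    by (auto simp: monom_bounded_def norm_divide)
  ultimately have "monom_bounded (0 + (vint n + (\<Sum>T\<in>#F. weight T)))
      (1 / fact (size F) * (\<Sum>Ts\<in>permutations_of_multiset F. ?c))
      (rho u F (monom a (vint n)))"
    unfolding rho_eq_sum_permutations by (intro monom_bounded_mult)
  then show ?thesis
    by (simp add: ac_simps)
qed

lemma rho_tree_monom_bounded:
  fixes u :: "'n::finite \<Rightarrow> int ^ 'n \<Rightarrow> complex"
  assumes u_supp: "\<And>i \<eta>. \<eta> \<notin> H_comp i \<Longrightarrow> u i \<eta> = 0"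
    and u_bound: "\<And>i \<eta>. \<eta> \<in> H \<Longrightarrow> norm (u i \<eta>) \<le> b \<eta>"
    and T: "set_rtree T \<subseteq> H"
  shows "monom_bounded (weight T + axis i 1) (tree_factor T * deco_prod b T) (rho_tree u T (X i))"
  using T
proof (induction T arbitrary: i)
  case (Node \<eta> F)
  have b: "0 \<le> b \<zeta>" if "\<zeta> \<in> H" for \<zeta>
    using u_bound [OF that] norm_ge_zero order_trans by blast
  let ?M = "\<lambda>T. tree_factor T * deco_prod b T"
  have M: "0 \<le> ?M T" if "T \<in># F" for T
    using Node.prems that b by (intro mult_nonneg_nonneg tree_factor_nonneg deco_prod_nonneg) auto
  have factor: "?M (Node \<eta> F) = b \<eta> * (real ((nat (deg \<eta>) + 1) choose size F) *
      real (card (permutations_of_multiset F))) * (\<Prod>T\<in>#F. ?M T)"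
    by (simp add: prod_mset.distrib)
  show ?case
  \<comment> \<open>If \<open>\<eta> + e\<^sub>i\<close> has a negative entry, the coefficient \<open>u i \<eta>\<close> is \<open>0\<close>.\<close>
  proof (cases "\<eta> \<in> H_comp i")
    case True
    then obtain n where n: "\<eta> = vint n - axis i 1" "2 \<le> total_degree n"
      by (auto simp: H_comp_def)
    then have "nat (deg \<eta>) + 1 = total_degree n"
      by (auto simp: deg_diff)
    moreover have "monom_bounded (vint n + (\<Sum>T\<in>#F. weight T))
        (norm (u i \<eta>) * (real (total_degree n choose size F) * real (card (permutations_of_multiset F))) *
          (\<Prod>T\<in>#F. ?M T))
        (rho u F (monom (u i \<eta>) (vint n)))"
    proof (rule rho_monom_bounded [OF Node.IH M])
      show "set_rtree T \<subseteq> H" if "T \<in># F" for T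
        using Node.prems that by auto
    qed
    moreover have "norm (u i \<eta>) * (real (total_degree n choose size F) *
          real (card (permutations_of_multiset F))) * (\<Prod>T\<in>#F. ?M T) \<le>
        b \<eta> * (real (total_degree n choose size F) * real (card (permutations_of_multiset F))) *
          (\<Prod>T\<in>#F. ?M T)"
      using Node.prems u_bound M by (intro mult_right_mono prod_mset_nonneg M) auto
    ultimately show ?thesis
      unfolding rho_tree_X factor
      by (auto simp: monom_bounded_def n ac_simps intro: order_trans)
  next
    case False
    then have "rho_tree u (Node \<eta> F) (X i) = 0"
      by (simp add: rho_tree_X u_supp rho_eq_sum_permutations)
    moreover have "0 \<le> ?M (Node \<eta> F)"
      using Node.prems b by (intro mult_nonneg_nonneg tree_factor_nonneg deco_prod_nonneg) auto
    ultimately show ?thesis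
      by (simp only: monom_bounded_0)
  qed
qed

lemma vanishes_normal_product:
  assumes "\<And>T i. T \<in> set Ts \<Longrightarrow> vanishes (Suc (d T)) (D T (X i))"
  shows "vanishes (sum_list (map d Ts)) (normal_product (map D Ts) g)"
  using assms
proof (induction Ts arbitrary: g)
  case (Cons T Ts)
  then have "vanishes (d T + sum_list (map d Ts)) (D T (X i) * normal_product (map D Ts) (pd i g))"
    for i by (intro vanishes_mult) (auto intro: vanishes_mono [of "Suc (d T)"])
  then show ?case
    by (auto simp: normal_product_Cons intro: vanishes_sum)
qed simp

lemma vanishes_rho:
  assumes "\<And>T i. T \<in># F \<Longrightarrow> vanishes (Suc (d T)) (rho_tree u T (X i))"
  shows "vanishes (\<Sum>T\<in>#F. d T) (rho u F g)"
  unfolding rho_eq_sum_permutations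
proof (intro vanishes_mult_right vanishes_sum)
  fix Ts
  assume "Ts \<in> permutations_of_multiset F"
  then have "F = mset Ts"
    by (simp add: permutations_of_multiset_def)
  then show "vanishes (\<Sum>T\<in>#F. d T) (normal_product (map (rho_tree u) Ts) g)"
    using vanishes_normal_product [of Ts d "rho_tree u" g] assms
    by (simp add: sum_mset_sum_list [symmetric])
qed

section \<open>Products of weights along admissible cuts\<close>

abbreviation uncut :: "'a rtree \<Rightarrow> ('a \<times> bool) rtree" where
  "uncut \<equiv> map_rtree (\<lambda>a. (a, False))"

primrec cut_root :: "'a rtree \<Rightarrow> ('a \<times> bool) rtree" where
  "cut_root (Node \<eta> F) = Node (\<eta>, True) (image_mset uncut F)"

lemma erase_uncut: "map_rtree fst (uncut T) = T"
  by (simp add: rtree.map_comp comp_def rtree.map_ident)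

lemma admissible_uncut: "admissible (uncut T)"
  by (induction T) auto

lemma remainder_uncut: "remainder (uncut T) = {#T#}"
proof (induction T)
  case (Node \<eta> F)
  then have "image_mset (\<lambda>S. remainder (uncut S)) F = image_mset (\<lambda>S. {#S#}) F"
    by (intro image_mset_cong) simp
  then show ?case
    by (simp add: comp_def image_mset.compositionality)
qed

lemma erase_cut_root: "map_rtree fst (cut_root T) = T"
  by (cases T) (simp add: erase_uncut image_mset.compositionality comp_def)

lemma admissible_cut_root: "admissible (cut_root T)"
  by (cases T) (auto simp: admissible_uncut rtree.set_map)

lemma remainder_cut_root: "remainder (cut_root T) = {#}"
  by (cases T) simp

abbreviation remaining_weight :: "('a::comm_monoid_add \<times> bool) rtree \<Rightarrow> 'a" where
  "remaining_weight c \<equiv> \<Sum>S\<in>#remainder c. weight S"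

lemma weight_remainders:
  "(\<Sum>S\<in>#(\<Sum>c\<in>#cs. remainder c). weight S) = (\<Sum>c\<in>#cs. remaining_weight c)"
  by (induction cs) simp_all

text \<open>\<open>\<beta>\<close> stands for the weight of the part of a tree that is kept in any case, and \<open>F\<close> for the trees that hang
  on it: however these are cut, the weight of what remains connected to the root lies in \<open>A\<close>.  A subtree
  of a tree in \<^const>\<open>trees_plus\<close> is in general not in \<^const>\<open>trees_plus\<close> itself: in the chain with
  decorations \<open>(1, 0), (-1, 2), (-1, 2), (1, 0)\<close>, the second and third have the sum \<open>(-2, 4)\<close>, which is not in \<^const>\<open>H\<close>, while
  all initial and final segments have sums in \<^const>\<open>H\<close>.  An induction therefore needs this relative notion.\<close>

definition trunk_in :: "'a::comm_monoid_add set \<Rightarrow> 'a \<Rightarrow> 'a forest \<Rightarrow> bool" where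
  "trunk_in A \<beta> F \<longleftrightarrow> (\<forall>cs. image_mset (map_rtree fst) cs = F \<and> (\<forall>c\<in>#cs. admissible c) \<longrightarrow>
    \<beta> + (\<Sum>c\<in>#cs. remaining_weight c) \<in> A)"

lemma trunk_inD:
  "trunk_in A \<beta> F \<Longrightarrow> image_mset (map_rtree fst) cs = F \<Longrightarrow> (\<And>c. c \<in># cs \<Longrightarrow> admissible c) \<Longrightarrow>
    \<beta> + (\<Sum>c\<in>#cs. remaining_weight c) \<in> A"
  by (auto simp: trunk_in_def)

lemma trunk_in_root:
  assumes "trunk_in A \<beta> F"
  shows "\<beta> \<in> A"
proof -
  have "\<beta> + (\<Sum>c\<in>#image_mset cut_root F. remaining_weight c) \<in> A"
    by (intro trunk_inD [OF assms])
      (auto simp: image_mset.compositionality comp_def erase_cut_root admissible_cut_root)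
  then show ?thesis
    by (simp add: image_mset.compositionality comp_def remainder_cut_root)
qed

text \<open>The other trees are cut at their roots, so that nothing remains of them.\<close>

lemma trunk_in_single: 
  assumes "trunk_in A \<beta> (add_mset T F)"
  shows "trunk_in A \<beta> {#T#}"
  unfolding trunk_in_def
proof (intro allI impI, elim conjE)
  fix cs
  assume "image_mset (map_rtree fst) cs = {#T#}" "\<forall>c\<in>#cs. admissible c"
  then have "\<beta> + (\<Sum>c\<in>#cs + image_mset cut_root F. remaining_weight c) \<in> A"
    by (intro trunk_inD [OF assms])
      (auto simp: image_mset.compositionality comp_def erase_cut_root admissible_cut_root)
  then show "\<beta> + (\<Sum>c\<in>#cs. remaining_weight c) \<in> A"
    by (simp add: image_mset.compositionality comp_def remainder_cut_root)
qed

text \<open>The tree \<open>T\<close> is left uncut and joins the part that is kept.\<close>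

lemma trunk_in_add:
  assumes "trunk_in A \<beta> (add_mset T F)"
  shows "trunk_in A (\<beta> + weight T) F"
  unfolding trunk_in_def
proof (intro allI impI, elim conjE)
  fix cs
  assume "image_mset (map_rtree fst) cs = F" "\<forall>c\<in>#cs. admissible c"
  then have "\<beta> + (\<Sum>c\<in>#add_mset (uncut T) cs. remaining_weight c) \<in> A"
    by (intro trunk_inD [OF assms]) (auto simp: erase_uncut admissible_uncut)
  then show "\<beta> + weight T + (\<Sum>c\<in>#cs. remaining_weight c) \<in> A"
    by (simp add: remainder_uncut ac_simps)
qed

text \<open>The root \<open>\<eta>\<close> is kept and its subtrees are cut.\<close>

lemma trunk_in_Node:
  assumes "trunk_in A \<beta> {#Node \<eta> F#}"
  shows "trunk_in A (\<beta> + \<eta>) F"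
  unfolding trunk_in_def
proof (intro allI impI, elim conjE)
  fix cs
  assume "image_mset (map_rtree fst) cs = F" "\<forall>c\<in>#cs. admissible c"
  then have "\<beta> + (\<Sum>c\<in>#{#Node (\<eta>, False) cs#}. remaining_weight c) \<in> A"
    by (intro trunk_inD [OF assms]) auto
  then show "\<beta> + \<eta> + (\<Sum>c\<in>#cs. remaining_weight c) \<in> A"
    by (simp add: weight_remainders ac_simps)
qed

lemma trees_plus_trunk_in:
  assumes "Node \<eta> F \<in> trees_plus"
  shows "trunk_in H \<eta> F"
  unfolding trunk_in_def
proof (intro allI impI, elim conjE)
  fix cs
  assume *: "image_mset (map_rtree fst) cs = F" "\<forall>c\<in>#cs. admissible c"
  let ?c = "Node (\<eta>, False) cs"
  have "map_rtree fst ?c = Node \<eta> F" "admissible ?c"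
    using * by auto
  then have "\<forall>S\<in>#remainder ?c + pruned ?c. weight S \<in> H"
    using assms unfolding trees_plus_def by blast
  then show "\<eta> + (\<Sum>c\<in>#cs. remaining_weight c) \<in> H"
    by (simp add: weight_remainders)
qed

context
  fixes A :: "'a::comm_monoid_add set" and b :: "'a \<Rightarrow> real"
  assumes nonneg: "\<And>\<eta>. \<eta> \<in> A \<Longrightarrow> 0 \<le> b \<eta>"
    and supermult: "\<And>\<eta> \<zeta>. \<eta> \<in> A \<Longrightarrow> \<zeta> \<in> A \<Longrightarrow> \<eta> + \<zeta> \<in> A \<Longrightarrow> b \<eta> * b \<zeta> \<le> b (\<eta> + \<zeta>)"
begin

text \<open>The trees of the forest are absorbed one after the other; after each step the argument of \<open>b\<close> is the
  weight of a trunk, hence in \<open>A\<close>, and the inequality for \<open>b\<close> applies again.  The inequality for a single tree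
  is the induction hypothesis in \<open>deco_prod_tree_le\<close>.\<close>

lemma deco_prod_forest_le_aux:
  assumes tree: "\<And>T \<beta>. T \<in># F \<Longrightarrow> \<beta> \<in> A \<Longrightarrow> trunk_in A \<beta> {#T#} \<Longrightarrow> 
      b \<beta> * deco_prod b T \<le> b (\<beta> + weight T)"
    and "\<And>T. T \<in># F \<Longrightarrow> set_rtree T \<subseteq> A" and "\<beta> \<in> A" and "trunk_in A \<beta> F"
  shows "b \<beta> * (\<Prod>T\<in>#F. deco_prod b T) \<le> b (\<beta> + (\<Sum>T\<in>#F. weight T))"
  using assms
proof (induction F arbitrary: \<beta>)
  case (add T F)
  have step: "b \<beta> * deco_prod b T \<le> b (\<beta> + weight T)"
    using add.prems trunk_in_single [OF add.prems(4)] by auto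
  have "b \<beta> * (\<Prod>T\<in>#add_mset T F. deco_prod b T) =
      (b \<beta> * deco_prod b T) * (\<Prod>T\<in>#F. deco_prod b T)"
    by simp
  also have "\<dots> \<le> b (\<beta> + weight T) * (\<Prod>T\<in>#F. deco_prod b T)"
    using add.prems(2) nonneg
    by (intro mult_right_mono step prod_mset_nonneg deco_prod_nonneg) auto
  also have "\<dots> \<le> b (\<beta> + weight T + (\<Sum>T\<in>#F. weight T))"
    using trunk_in_add [OF add.prems(4)] add.prems by (intro add.IH trunk_in_root) auto
  finally show ?case
    by (simp add: ac_simps)
qed simp

lemma deco_prod_tree_le:
  assumes "set_rtree T \<subseteq> A" "\<beta> \<in> A" "trunk_in A \<beta> {#T#}"
  shows "b \<beta> * deco_prod b T \<le> b (\<beta> + weight T)"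
  using assms
proof (induction T arbitrary: \<beta>)
  case (Node \<eta> F)
  have trunk: "trunk_in A (\<beta> + \<eta>) F"
    using Node.prems(3) by (rule trunk_in_Node)
  have "0 \<le> (\<Prod>T\<in>#F. deco_prod b T)"
    using Node.prems(1) nonneg by (intro prod_mset_nonneg deco_prod_nonneg) auto
  then have "b \<beta> * b \<eta> * (\<Prod>T\<in>#F. deco_prod b T) \<le> b (\<beta> + \<eta>) * (\<Prod>T\<in>#F. deco_prod b T)"
    using Node.prems trunk_in_root [OF trunk] by (intro mult_right_mono supermult) auto
  also have "\<dots> \<le> b (\<beta> + \<eta> + (\<Sum>T\<in>#F. weight T))"
    using Node trunk trunk_in_root [OF trunk] by (intro deco_prod_forest_le_aux) auto
  finally show ?case
    by (simp add: ac_simps)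
qed

lemma deco_prod_forest_le:
  assumes "\<And>T. T \<in># F \<Longrightarrow> set_rtree T \<subseteq> A" "trunk_in A \<beta> F"
  shows "b \<beta> * (\<Prod>T\<in>#F. deco_prod b T) \<le> b (\<beta> + (\<Sum>T\<in>#F. weight T))"
  using assms trunk_in_root [of A \<beta> F] by (intro deco_prod_forest_le_aux deco_prod_tree_le) auto

end

text \<open>The inequality for \<open>b\<close> is available only when the sum of the two weights lies in \<^const>\<open>H\<close>.  If a tree of
  \<^const>\<open>trees_plus\<close> is built up vertex by vertex from its root, then every intermediate tree is a remainder of an admissible
  cut and has its weight in \<^const>\<open>H\<close>.\<close>

lemma deco_prod_le_weight:
  assumes "\<And>\<eta>. \<eta> \<in> H \<Longrightarrow> 0 \<le> b \<eta>"
    and "\<And>\<eta> \<zeta>. \<eta> \<in> H \<Longrightarrow> \<zeta> \<in> H \<Longrightarrow> \<eta> + \<zeta> \<in> H \<Longrightarrow> b \<eta> * b \<zeta> \<le> b (\<eta> + \<zeta>)"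
    and "T \<in> trees_plus"
  shows "deco_prod b T \<le> b (weight T)"
proof (cases T)
  case (Node \<eta> F)
  have "b \<eta> * (\<Prod>S\<in>#F. deco_prod b S) \<le> b (\<eta> + (\<Sum>S\<in>#F. weight S))"
    using assms by (intro deco_prod_forest_le [of H] trees_plus_trunk_in) (auto simp: Node trees_plus_def)
  then show ?thesis
    by (simp add: Node)
qed

section \<open>The majorant series of trees\<close>

lemma sum_lists_prod_list:
  fixes m :: "'a \<Rightarrow> 'b::comm_semiring_1"
  assumes "finite S"
  shows "(\<Sum>xs | set xs \<subseteq> S \<and> length xs = s. prod_list (map m xs)) = (\<Sum>x\<in>S. m x) ^ s"
proof (induction s)
  case 0
  have "{xs. set xs \<subseteq> S \<and> length xs = 0} = {[]}"
    by auto
  then show ?case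
    by simp
next
  case (Suc s)
  then show ?case
    by (simp add: sum_lists_Suc [OF assms] sum_distrib_right flip: sum_distrib_left)
qed

text \<open>For a set of trees with generating function \<open>g\<close>, this is the contribution \<open>(1 + g)\<^sup>k\<close> of all possible forests
  of subtrees at a vertex whose decoration \<open>\<eta>\<close> satisfies \<open>k = |\<eta>| + 1\<close>.\<close>

lemma sum_multisets_binomial:
  fixes m :: "'a \<Rightarrow> real"
  assumes "finite S" "k \<le> K"
  shows "(\<Sum>F | set_mset F \<subseteq> S \<and> size F \<le> K. real (k choose size F) *
      real (card (permutations_of_multiset F)) * (\<Prod>x\<in>#F. m x)) = (1 + (\<Sum>x\<in>S. m x)) ^ k"
    (is "sum ?h ?M = _")
proof -
  let ?Ms = "\<lambda>s. {F. set_mset F \<subseteq> S \<and> size F = s}"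
  have level: "(\<Sum>F\<in>?Ms s. ?h F) = real (k choose s) * (\<Sum>x\<in>S. m x) ^ s" for s
  proof -
    have "(\<Sum>F\<in>?Ms s. ?h F) = (\<Sum>F\<in>?Ms s. real (k choose s) *
        (\<Sum>xs\<in>permutations_of_multiset F. prod_list (map m xs)))"
    proof (intro sum.cong refl)
      fix F assume F: "F \<in> ?Ms s"
      have "prod_list (map m xs) = (\<Prod>x\<in>#F. m x)" if "xs \<in> permutations_of_multiset F" for xs
        using that by (auto simp: permutations_of_multiset_def prod_mset_prod_list [symmetric])
      then show "?h F = real (k choose s) *
          (\<Sum>xs\<in>permutations_of_multiset F. prod_list (map m xs))"
        using F by simp
    qed
    then show ?thesis
      by (simp only: sum_distrib_left [symmetric] sum_permutations_of_multisets [OF assms(1)]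
          sum_lists_prod_list [OF assms(1)])
  qed
  have "sum ?h ?M = (\<Sum>s\<le>K. \<Sum>F\<in>{F \<in> ?M. size F = s}. ?h F)"
    by (rule sum.group [symmetric]) (auto simp: finite_multisets_bounded [OF assms(1)])
  also have "\<dots> = (\<Sum>s\<le>K. \<Sum>F\<in>?Ms s. ?h F)"
    by (intro sum.cong arg_cong2 [where f = sum] refl) auto
  also have "\<dots> = (\<Sum>s\<le>K. real (k choose s) * (\<Sum>x\<in>S. m x) ^ s)"
    by (simp only: level)
  also have "\<dots> = (\<Sum>s\<le>k. real (k choose s) * (\<Sum>x\<in>S. m x) ^ s)"
    using assms(2) by (intro sum.mono_neutral_right) (auto simp: binomial_eq_0)
  also have "\<dots> = (1 + (\<Sum>x\<in>S. m x)) ^ k"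
    using binomial_ring [of "\<Sum>x\<in>S. m x" 1 k] by (simp add: add.commute)
  finally show ?thesis .
qed

lemma in_H_obtain:
  assumes "\<eta> \<in> H"
  obtains i n where "\<eta> = vint n - axis i 1" "total_degree n \<ge> 2" "deg \<eta> = int (total_degree n) - 1"
  using assms by (auto simp: H_def H_comp_def deg_diff)

lemma deg_ge_1: "\<eta> \<in> H \<Longrightarrow> deg \<eta> \<ge> 1"
  by (erule in_H_obtain) simp

lemma finite_H_deg_le: "finite {\<eta> :: int ^ 'n::finite. \<eta> \<in> H \<and> deg \<eta> \<le> int N}"
proof (rule finite_subset)
  show "{\<eta> :: int ^ 'n. \<eta> \<in> H \<and> deg \<eta> \<le> int N} \<subseteq>
      (\<lambda>(i, n). vint n - axis i 1) ` (UNIV \<times> {n. total_degree n \<le> Suc N})"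
  proof (rule subsetI, elim CollectE conjE)
    fix \<eta> :: "int ^ 'n"
    assume "\<eta> \<in> H" and deg: "deg \<eta> \<le> int N"
    then obtain i n where "\<eta> = vint n - axis i 1" "deg \<eta> = int (total_degree n) - 1"
      by (metis in_H_obtain)
    then show "\<eta> \<in> (\<lambda>(i, n). vint n - axis i 1) ` (UNIV \<times> {n. total_degree n \<le> Suc N})"
      using deg by (intro image_eqI [of _ _ "(i, n)"]) auto
  qed
qed (simp add: finite_total_le)

lemma sum_half_power_total_le:
  assumes "finite M"
  shows "(\<Sum>n\<in>M. (1/2) ^ total_degree (n :: nat ^ 'n::finite)) \<le> (2 :: real) ^ CARD('n)"
proof -
  obtain N where N: "\<forall>k\<in>total_degree ` M. k \<le> N"
    using assms finite_nat_set_iff_bounded_le by blast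
  have le: "n $ i \<le> N" if "n \<in> M" for n i
    using component_le_total [of n i] N that by force
  have "(\<Sum>n\<in>M. (1/2) ^ total_degree n :: real) \<le>
      (\<Sum>g\<in>PiE (UNIV :: 'n set) (\<lambda>_. {..N}). \<Prod>i\<in>UNIV. (1/2) ^ g i)"
  proof (intro sum_le_included [where i = "\<lambda>g :: 'n \<Rightarrow> nat. \<chi> i. g i"] finite_PiE ballI)
    fix n assume "n \<in> M"
    with le show "\<exists>g\<in>PiE (UNIV :: 'n set) (\<lambda>_. {..N}). (\<chi> i. g i) = n \<and>
        (1/2) ^ total_degree n \<le> (\<Prod>i\<in>UNIV. (1/2 :: real) ^ g i)"
      by (intro bexI [of _ "vec_nth n"]) (auto simp: total_degree_def power_sum)
  qed (use assms in \<open>auto intro: prod_nonneg\<close>)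
  also have "\<dots> = (\<Prod>i\<in>(UNIV :: 'n set). \<Sum>k\<le>N. (1/2) ^ k)"
    by (rule prod_sum_PiE [symmetric]) auto
  also have "\<dots> \<le> (\<Prod>i\<in>(UNIV :: 'n set). 2)"
  proof -
    have "(\<Sum>k\<le>N. (1/2) ^ k) = (2 - (1/2) ^ N :: real)"
      by (induction N) auto
    moreover have "(0 :: real) \<le> (1/2) ^ N" "(1/2) ^ N \<le> (1 :: real)"
      by (simp_all add: power_le_one)
    ultimately show ?thesis
      by (intro prod_mono) auto
  qed
  finally show ?thesis
    by simp
qed

text \<open>An element of \<open>H\<close> is \<open>n - e\<^sub>i\<close> with \<open>|n| \<ge> 2\<close>, hence \<open>|n| \<le> 2 (|n| - 1)\<close> and \<open>(s/4)\<^bsup>|n| - 1\<^esup> \<le> s (1/2)\<^bsup>|n|\<^esup>\<close>.  The sum of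
  \<open>(1/2)\<^bsup>|n|\<^esup>\<close> over all \<open>n\<close> is a product of geometric series.\<close>

lemma sum_H_powi_le:
  fixes S :: "(int ^ 'n::finite) set"
  assumes "finite S" "S \<subseteq> H" and s: "0 < s" "s \<le> 1"
  shows "(\<Sum>\<eta>\<in>S. (s / 4) powi deg \<eta>) \<le> s * (real CARD('n) * 2 ^ CARD('n))"
proof -
  have "\<exists>p. \<eta> = vint (snd p) - axis (fst p) 1 \<and> (s / 4) powi deg \<eta> \<le> s * (1/2) ^ total_degree (snd p)"
    if "\<eta> \<in> S" for \<eta>
  proof -
    from that assms(2) have "\<eta> \<in> H"
      by blast
    then obtain i n where n: "\<eta> = vint n - axis i 1" "total_degree n \<ge> 2" "deg \<eta> = int (total_degree n) - 1"
      by (rule in_H_obtain)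
    then obtain k where k: "total_degree n = Suc (Suc k)"
      by (metis add_2_eq_Suc le_Suc_ex)
    have "(s / 4) powi deg \<eta> = (s / 4) powi int (Suc k)"
      using k n(3) by simp
    also have "\<dots> = (s / 4) ^ Suc k"
      by (rule power_int_of_nat)
    also have "\<dots> = s * (s ^ k * (1/4) ^ Suc k)"
      by (simp add: power_divide)
    also have "\<dots> \<le> s * (1 * (1/2) ^ total_degree n)"
    proof (intro mult_left_mono mult_mono)
      have "(1/4 :: real) ^ Suc k = (1/2) ^ (2 * Suc k)"
        by (simp add: power_mult power2_eq_square)
      also have "\<dots> \<le> (1/2) ^ total_degree n"
        using k by (intro power_decreasing) auto
      finally show "(1/4 :: real) ^ Suc k \<le> (1/2) ^ total_degree n" .
    qed (use s in \<open>auto intro: power_le_one\<close>)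
    finally show ?thesis
      using n(1) by (intro exI [of _ "(i, n)"]) simp
  qed
  then obtain p where p: "\<And>\<eta>. \<eta> \<in> S \<Longrightarrow> \<eta> = vint (snd (p \<eta>)) - axis (fst (p \<eta>)) 1 \<and>
      (s / 4) powi deg \<eta> \<le> s * (1/2) ^ total_degree (snd (p \<eta>))"
    by metis
  let ?M = "snd ` p ` S"
  have "(\<Sum>\<eta>\<in>S. (s / 4) powi deg \<eta>) \<le>
      (\<Sum>(i, n)\<in>(UNIV :: 'n set) \<times> ?M. s * (1/2) ^ total_degree n)"
  proof (intro sum_le_included [where i = "\<lambda>(i :: 'n, n). vint n - axis i 1"] ballI)
    fix \<eta> assume \<eta>: "\<eta> \<in> S"
    show "\<exists>q\<in>UNIV \<times> ?M. (case q of (i, n) \<Rightarrow> vint n - axis i 1) = \<eta> \<and>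
        (s / 4) powi deg \<eta> \<le> (case q of (i, n) \<Rightarrow> s * (1/2) ^ total_degree n)"
    proof (rule bexI [of _ "p \<eta>"])
      show "p \<eta> \<in> UNIV \<times> ?M"
        using \<eta> by (metis SigmaI UNIV_I image_eqI prod.collapse)
    qed (use p [OF \<eta>] in \<open>simp add: split_def\<close>)
  qed (use assms in auto)
  also have "\<dots> = s * (real CARD('n) * (\<Sum>n\<in>?M. (1/2) ^ total_degree n))"
    by (simp add: sum.cartesian_product [symmetric] sum_distrib_left ac_simps)
  also have "\<dots> \<le> s * (real CARD('n) * 2 ^ CARD('n))"
    using assms by (intro mult_left_mono sum_half_power_total_le) auto
  finally show ?thesis .
qed

definition trees_upto :: "nat \<Rightarrow> (int ^ 'n::finite) rtree set" where
  "trees_upto N = {T. set_rtree T \<subseteq> H \<and> gr_tree T \<le> int N}"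

lemma sum_mset_ge_size:
  fixes h :: "'a \<Rightarrow> 'b::linordered_semidom"
  assumes "\<And>x. x \<in># F \<Longrightarrow> 1 \<le> h x"
  shows "of_nat (size F) \<le> (\<Sum>x\<in>#F. h x)"
  using assms by (induction F) (auto intro: add_mono)

lemma gr_tree_ge_1: "set_rtree T \<subseteq> H \<Longrightarrow> 1 \<le> gr_tree T"
proof (induction T)
  case (Node \<eta> F)
  have "int (size F) \<le> (\<Sum>T\<in>#F. gr_tree T)"
    using Node by (intro sum_mset_ge_size) auto
  moreover have "1 \<le> deg \<eta>"
    using Node.prems by (intro deg_ge_1) auto
  ultimately show ?case
    by simp
qed

lemma trees_upto_0: "trees_upto 0 = {}"
  using gr_tree_ge_1 by (force simp: trees_upto_def)

text \<open>Every decoration has degree at least \<open>1\<close>, so the subtrees at the root have smaller grade than the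
  tree, and their number is less than its grade.  The larger bound \<open>N + 2\<close> leaves room for all terms of the
  binomial expansion with exponent \<open>|\<eta>| + 1\<close>, where \<open>|\<eta>| \<le> N + 1\<close>.\<close>

lemma trees_upto_Suc_subset:
  "(trees_upto (Suc N) :: (int ^ 'n::finite) rtree set) \<subseteq> (\<lambda>(\<eta>, F). Node \<eta> F) `
    ({\<eta>. \<eta> \<in> H \<and> deg \<eta> \<le> int (Suc N)} \<times>
     {F. set_mset F \<subseteq> trees_upto N \<and> size F \<le> Suc (Suc N)})"
proof
  fix T :: "(int ^ 'n) rtree"
  assume T: "T \<in> trees_upto (Suc N)"
  obtain \<eta> F where [simp]: "T = Node \<eta> F"
    by (cases T)
  have \<eta>: "\<eta> \<in> H" and F: "\<And>S. S \<in># F \<Longrightarrow> set_rtree S \<subseteq> H"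
    and gr: "deg \<eta> + (\<Sum>S\<in>#F. gr_tree S) \<le> int (Suc N)"
    using T by (auto simp: trees_upto_def)
  have size: "int (size F) \<le> (\<Sum>S\<in>#F. gr_tree S)"
    by (intro sum_mset_ge_size gr_tree_ge_1 F)
  have "gr_tree S \<le> int N" if S: "S \<in># F" for S
  proof -
    obtain F' where F': "F = add_mset S F'"
      using multi_member_split [OF S] by blast
    have "int (size F') \<le> (\<Sum>S\<in>#F'. gr_tree S)"
      using F F' by (intro sum_mset_ge_size gr_tree_ge_1) auto
    then show ?thesis
      using gr deg_ge_1 [OF \<eta>] by (simp add: F')
  qed
  then have "set_mset F \<subseteq> trees_upto N"
    using F by (auto simp: trees_upto_def)
  moreover have "deg \<eta> \<le> int (Suc N)" "size F \<le> Suc (Suc N)"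
    using gr size deg_ge_1 [OF \<eta>] by auto
  ultimately show "T \<in> (\<lambda>(\<eta>, F). Node \<eta> F) `
      ({\<eta>. \<eta> \<in> H \<and> deg \<eta> \<le> int (Suc N)} \<times>
       {F. set_mset F \<subseteq> trees_upto N \<and> size F \<le> Suc (Suc N)})"
    using \<eta> by auto
qed

lemma finite_trees_upto: "finite (trees_upto N :: (int ^ 'n::finite) rtree set)"
proof (induction N)
  case (Suc N)
  then show ?case
    by (intro finite_subset [OF trees_upto_Suc_subset] finite_imageI finite_cartesian_product
        finite_H_deg_le finite_multisets_bounded)
qed (simp add: trees_upto_0)

lemma powi_sum_mset:
  "t \<noteq> 0 \<Longrightarrow> t powi (\<Sum>x\<in>#F. h x) = (\<Prod>x\<in>#F. t powi h x :: real)"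
  by (induction F) (simp_all add: power_int_add)

text \<open>Let \<open>g\<^sub>N(t)\<close> be the sum.  Removing the root gives \<open>g\<^bsub>N+1\<^esub>(t) \<le> \<Sum> t\<^bsup>|\<eta>|\<^esup> (1 + g\<^sub>N(t))\<^bsup>|\<eta>| + 1\<^esup>\<close> over the decorations
  \<open>\<eta>\<close>, and \<open>g\<^sub>N(t) \<le> 1\<close> bounds the right-hand side by \<open>2 \<Sum> (2t)\<^bsup>|\<eta>|\<^esup>\<close>.  The value of \<open>t\<close> is chosen to make this at
  most \<open>1\<close> in \<open>sum_H_powi_le\<close>.\<close>

lemma sum_trees_upto_le_1:
  fixes t :: real
  defines "t \<equiv> 1 / (16 * (real CARD('n::finite) * 2 ^ CARD('n)))"
  shows "(\<Sum>T\<in>trees_upto N. tree_factor (T :: (int ^ 'n) rtree) * t powi gr_tree T) \<le> 1"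
proof (induction N)
  case (Suc N)
  define m where "m = (\<lambda>T :: (int ^ 'n) rtree. tree_factor T * t powi gr_tree T)"
  define s where "s = 1 / (2 * (real CARD('n) * 2 ^ CARD('n)))"
  have c: "1 \<le> real CARD('n) * 2 ^ CARD('n)"
  proof -
    have "1 * 1 \<le> real CARD('n) * 2 ^ CARD('n)"
      by (intro mult_mono) (auto simp: Suc_leI One_nat_def)
    then show ?thesis by simp
  qed
  then have s: "0 < s" "s \<le> 1" and t: "0 < t" "2 * t = s / 4"
    by (auto simp: s_def t_def divide_simps)
  let ?D = "{\<eta> :: int ^ 'n. \<eta> \<in> H \<and> deg \<eta> \<le> int (Suc N)}"
  let ?M = "{F :: (int ^ 'n) forest. set_mset F \<subseteq> trees_upto N \<and> size F \<le> Suc (Suc N)}"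
  have m: "0 \<le> m T" for T
    using t by (auto simp: m_def intro!: mult_nonneg_nonneg tree_factor_nonneg)
  have m_Node: "m (Node \<eta> F) = t powi deg \<eta> * (real ((nat (deg \<eta>) + 1) choose size F) *
      real (card (permutations_of_multiset F)) * (\<Prod>T\<in>#F. m T))" for \<eta> F
    using t by (simp add: m_def power_int_add powi_sum_mset prod_mset.distrib)
  have finM: "finite ?M"
    by (rule finite_multisets_bounded [OF finite_trees_upto])
  have "sum m (trees_upto (Suc N)) \<le> sum m ((\<lambda>(\<eta>, F). Node \<eta> F) ` (?D \<times> ?M))"
    using m finM by (intro sum_mono2 trees_upto_Suc_subset finite_imageI finite_cartesian_product
        finite_H_deg_le) auto
  also have "\<dots> = (\<Sum>(\<eta>, F)\<in>?D \<times> ?M. m (Node \<eta> F))"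
    by (subst sum.reindex) (auto simp: inj_on_def split_def)
  also have "\<dots> = (\<Sum>\<eta>\<in>?D. t powi deg \<eta> * (1 + (\<Sum>T\<in>trees_upto N. m T)) ^ (nat (deg \<eta>) + 1))"
  proof -
    have "(\<Sum>F\<in>?M. m (Node \<eta> F)) =
        t powi deg \<eta> * (1 + (\<Sum>T\<in>trees_upto N. m T)) ^ (nat (deg \<eta>) + 1)" if "\<eta> \<in> ?D" for \<eta>
      unfolding m_Node sum_distrib_left [symmetric]
      using that by (subst sum_multisets_binomial) (auto simp: finite_trees_upto)
    then show ?thesis
      by (simp add: sum.cartesian_product [symmetric])
  qed
  also have "\<dots> \<le> (\<Sum>\<eta>\<in>?D. 2 * (s / 4) powi deg \<eta>)"
  proof (rule sum_mono)
    fix \<eta> assume "\<eta> \<in> ?D"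
    then have d: "deg \<eta> = int (nat (deg \<eta>))"
      using deg_ge_1 by force
    have "(\<Sum>T\<in>trees_upto N. m T) \<le> 1"
      using Suc.IH by (simp add: m_def)
    then have "(1 + (\<Sum>T\<in>trees_upto N. m T)) ^ (nat (deg \<eta>) + 1) \<le> 2 ^ (nat (deg \<eta>) + 1)"
      using sum_nonneg [of "trees_upto N" m] m by (intro power_mono) auto
    then have "t powi deg \<eta> * (1 + (\<Sum>T\<in>trees_upto N. m T)) ^ (nat (deg \<eta>) + 1) \<le>
        t powi deg \<eta> * 2 ^ (nat (deg \<eta>) + 1)"
      using t by (intro mult_left_mono) auto
    also have "\<dots> = 2 * (2 * t) powi deg \<eta>"
      by (subst d, subst (2) d) (simp only: power_int_of_nat power_mult_distrib power_add, simp)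
    finally show "t powi deg \<eta> * (1 + (\<Sum>T\<in>trees_upto N. m T)) ^ (nat (deg \<eta>) + 1) \<le>
        2 * (s / 4) powi deg \<eta>"
      by (simp only: t)
  qed
  also have "\<dots> \<le> 2 * (s * (real CARD('n) * 2 ^ CARD('n)))"
    unfolding sum_distrib_left [symmetric]
    by (intro mult_left_mono sum_H_powi_le finite_H_deg_le s) auto
  also have "\<dots> = 1"
    by (simp add: s_def)
  finally show ?case
    by (simp add: m_def)
qed (simp add: trees_upto_0)

text \<open>A convergent majorant series has geometrically bounded coefficients.\<close>

lemma sum_tree_factor_le:
  fixes K :: real
  defines "K \<equiv> 16 * (real CARD('n::finite) * 2 ^ CARD('n))"
  shows "(\<Sum>T\<in>{T \<in> trees_upto N. gr_tree T = k}. tree_factor (T :: (int ^ 'n) rtree)) \<le> K powi k"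
proof -
  have K: "0 < K"
    by (simp add: K_def)
  let ?S = "{T \<in> trees_upto N. gr_tree T = k} :: (int ^ 'n) rtree set"
  have "(\<Sum>T\<in>?S. tree_factor T) * (1 / K) powi k = (\<Sum>T\<in>?S. tree_factor T * (1 / K) powi gr_tree T)"
    by (simp add: sum_distrib_right)
  also have "\<dots> \<le> (\<Sum>T\<in>trees_upto N. tree_factor (T :: (int ^ 'n) rtree) * (1 / K) powi gr_tree T)"
    using K by (intro sum_mono2 finite_trees_upto) (auto intro!: mult_nonneg_nonneg tree_factor_nonneg)
  also have "\<dots> \<le> 1"
    unfolding K_def by (rule sum_trees_upto_le_1)
  finally show ?thesis
    using K by (simp add: power_int_divide_distrib field_simps)
qed

section \<open>The series over the forests\<close>

lemma character_basis_forest: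
  fixes f :: "((int ^ 'n::finite) forest \<Rightarrow>\<^sub>0 complex) \<Rightarrow> complex"
  assumes f: "character f" and F: "F \<in> forests_plus"
  shows "f (basis_forest F) = (\<Prod>T\<in>#F. f (basis_forest {#T#}))"
  using F
proof (induction F)
  case empty
  have "basis_forest {#} = (1 :: (int ^ 'n) forest \<Rightarrow>\<^sub>0 complex)"
    by (simp add: basis_forest_def)
  then show ?case
    using f by (simp add: character_def)
next
  case (add T F)
  then have F: "F \<in> forests_plus" and T: "{#T#} \<in> forests_plus"
    by (auto simp: forests_plus_def)
  have "basis_forest (add_mset T F) = basis_forest {#T#} * basis_forest F"
    by (simp add: basis_forest_def mult_single)
  moreover have "basis_forest {#T#} \<in> CK_plus" "basis_forest F \<in> CK_plus"
    using F T by (auto simp: CK_plus_def intro: CK.span_base)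
  ultimately show ?case
    using f add.IH [OF F] by (simp add: character_def)
qed

text \<open>The weight of \<open>T\<close> has degree \<^term>\<open>gr_tree T\<close>; any finite bound on the coefficients \<open>u\<close> serves to obtain the
  shape of the monomial.\<close>

lemma vanishes_rho_tree_X:
  fixes u :: "'n::finite \<Rightarrow> int ^ 'n \<Rightarrow> complex"
  assumes "\<And>i \<eta>. \<eta> \<notin> H_comp i \<Longrightarrow> u i \<eta> = 0" and T: "set_rtree T \<subseteq> H"
  shows "vanishes (Suc (nat (gr_tree T))) (rho_tree u T (X i))"
proof -
  have "norm (u i \<eta>) \<le> (\<Sum>j\<in>UNIV. norm (u j \<eta>))" for i \<eta>
    by (rule member_le_sum) auto
  then obtain a where "rho_tree u T (X i) = monom a (weight T + axis i 1)"
    using rho_tree_monom_bounded [where u = u and b = "\<lambda>\<eta>. \<Sum>j\<in>UNIV. norm (u j \<eta>)" and i = i,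
        OF assms(1) _ T] that
    unfolding monom_bounded_def by blast
  moreover have "Suc (nat (gr_tree T)) \<le> nat (deg (weight T + axis i 1))"
    using gr_tree_ge_1 [OF T] by (simp add: deg_add deg_weight)
  ultimately show ?thesis
    by (simp add: vanishes_monom)
qed

lemma sum_mset_member_le: "x \<in># F \<Longrightarrow> h x \<le> (\<Sum>y\<in>#F. h y :: nat)"
  by (induction F) auto

definition trees_plus_upto :: "nat \<Rightarrow> (int ^ 'n::finite) rtree set" where
  "trees_plus_upto N = trees_plus \<inter> trees_upto N"

lemma finite_trees_plus_upto: "finite (trees_plus_upto N)"
  by (simp add: trees_plus_upto_def finite_trees_upto)

context
  fixes u :: "'n::finite \<Rightarrow> int ^ 'n \<Rightarrow> complex"
    and f :: "((int ^ 'n) forest \<Rightarrow>\<^sub>0 complex) \<Rightarrow> complex"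
  assumes u_supp: "\<And>i \<eta>. \<eta> \<notin> H_comp i \<Longrightarrow> u i \<eta> = 0"
    and f: "character f"
begin

text \<open>The vector field whose exponential is the series over the forests, without the trees
  of grade above \<open>N\<close>.\<close>

definition tree_field :: "nat \<Rightarrow> 'n \<Rightarrow> 'n mps" where
  "tree_field N i = (\<Sum>T\<in>trees_plus_upto N. const (f (basis_forest {#T#})) * rho_tree u T (X i))"

lemma vanishes_tree_field: "vanishes 2 (tree_field N i)"
  unfolding tree_field_def
proof (intro vanishes_sum vanishes_mult_right)
  fix T :: "(int ^ 'n) rtree"
  assume "T \<in> trees_plus_upto N"
  then have T: "set_rtree T \<subseteq> H"
    by (simp add: trees_plus_upto_def trees_upto_def)
  show "vanishes 2 (rho_tree u T (X i))"
    by (rule vanishes_mono [OF vanishes_rho_tree_X [OF u_supp T]]) (use gr_tree_ge_1 [OF T] in auto)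
qed

text \<open>The operator of a forest raises the order by the grade.  A forest that is not among the finitely
  many of at most \<open>N\<close> trees of grade at most \<open>N\<close> has grade above \<open>N\<close>, since every tree has grade at least \<open>1\<close>.\<close>

lemma forest_series_cong_taylor:
  "cong_mod (Suc N) (forest_series f u g) (taylor (tree_field N) N g)"
proof -
  let ?S = "trees_plus_upto N :: (int ^ 'n) rtree set"
  let ?M = "{F. set_mset F \<subseteq> ?S \<and> size F \<le> N}"
  have "cong_mod (Suc N) (forest_series f u g)
      (\<Sum>F\<in>?M. const (f (basis_forest F)) * rho u F g)"
    unfolding forest_series_def
  proof (rule cong_mod_formal_sum)
    show "?M \<subseteq> forests_plus"
      by (auto simp: forests_plus_def trees_plus_upto_def)
    show "finite ?M"
      by (rule finite_multisets_bounded [OF finite_trees_plus_upto])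
    fix F assume F: "F \<in> forests_plus - ?M"
    then have trees: "set_rtree T \<subseteq> H" if "T \<in># F" for T
      using that by (auto simp: forests_plus_def trees_plus_def)
    have "Suc N \<le> (\<Sum>T\<in>#F. nat (gr_tree T))"
    proof (cases "set_mset F \<subseteq> ?S")
      case True
      then have "Suc N \<le> size F"
        using F by simp
      moreover have "of_nat (size F) \<le> (\<Sum>T\<in>#F. nat (gr_tree T))"
        using gr_tree_ge_1 [OF trees] by (intro sum_mset_ge_size) force
      ultimately show ?thesis
        by simp
    next
      case False
      then obtain T where T: "T \<in># F" "T \<notin> ?S"
        by auto
      then have "int N < gr_tree T"
        using F trees [OF T(1)] by (auto simp: forests_plus_def trees_plus_upto_def trees_upto_def)
      then show ?thesis
        using sum_mset_member_le [OF T(1), of "\<lambda>T. nat (gr_tree T)"] by simp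
    qed
    then show "vanishes (Suc N) (const (f (basis_forest F)) * rho u F g)"
      by (intro vanishes_mult_right vanishes_rho_tree_X u_supp trees
          vanishes_mono [OF vanishes_rho [where d = "\<lambda>T. nat (gr_tree T)"]])
  qed
  also have "(\<Sum>F\<in>?M. const (f (basis_forest F)) * rho u F g) =
      (\<Sum>F\<in>?M. const (\<Prod>T\<in>#F. f (basis_forest {#T#})) * rho u F g)"
    by (intro sum.cong refl arg_cong2 [where f = "(*)"] arg_cong [where f = const]
        character_basis_forest f) (auto simp: forests_plus_def trees_plus_upto_def)
  also have "\<dots> = taylor (tree_field N) N g"
    unfolding sum_forests_eq_taylor [OF finite_trees_plus_upto] by (simp add: tree_field_def [abs_def])
  finally show ?thesis .
qed

lemma forest_series_X_cong: "1 \<le> N \<Longrightarrow> cong_mod (Suc N) (forest_series f u (X i)) (X i + tree_field N i)"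
  using forest_series_cong_taylor [of N "X i"] by (simp add: taylor_X)

lemma forest_series_X_in_G: "(\<lambda>i. forest_series f u (X i)) \<in> G"
  unfolding in_G_iff
proof
  fix i
  have "cong_mod 2 (forest_series f u (X i)) (X i + tree_field 1 i)"
    using forest_series_X_cong [of 1 i] by (simp add: numeral_2_eq_2 One_nat_def)
  also have "cong_mod 2 (X i + tree_field 1 i) (X i)"
    using vanishes_tree_field by (simp add: cong_mod_def)
  finally show "cong_mod 2 (forest_series f u (X i)) (X i)" .
qed

text \<open>Additivity, multiplicativity and continuity are those of the truncated Taylor shifts.\<close>

lemma forest_series_eq_Theta: "forest_series f u = Theta (\<lambda>i. forest_series f u (X i))"
proof (rule substitution_operator_eq_Theta)
  let ?L = "forest_series f u"
  note L = forest_series_cong_taylor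
  fix g h
  show "?L (g + h) = ?L g + ?L h"
  proof (rule eq_if_cong_mod)
    fix N
    have "cong_mod (Suc N) (?L (g + h)) (taylor (tree_field N) N g + taylor (tree_field N) N h)"
      using L [of N "g + h"] by (simp add: taylor_add)
    also have "cong_mod (Suc N) \<dots> (?L g + ?L h)"
      by (intro cong_mod_add cong_mod_sym [OF L])
    finally show "cong_mod (Suc N) (?L (g + h)) (?L g + ?L h)" .
  qed
  show "?L (g * h) = ?L g * ?L h"
  proof (rule eq_if_cong_mod)
    fix N
    have "cong_mod (Suc N) (?L (g * h)) (taylor (tree_field N) N (g * h))"
      by (rule L)
    also have "cong_mod (Suc N) \<dots> (taylor (tree_field N) N g * taylor (tree_field N) N h)"
      by (rule taylor_mult [OF vanishes_tree_field])
    also have "cong_mod (Suc N) \<dots> (?L g * ?L h)"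
      by (intro cong_mod_mult cong_mod_sym [OF L])
    finally show "cong_mod (Suc N) (?L (g * h)) (?L g * ?L h)" .
  qed
next
  fix c
  show "forest_series f u (const c) = const c"
    using forest_series_cong_taylor [of _ "const c"] by (intro eq_if_cong_mod) (simp add: taylor_const)
next
  fix M and g :: "'n mps"
  assume g: "vanishes M g"
  show "vanishes M (forest_series f u g)"
    unfolding vanishes_def
  proof (intro allI impI)
    fix m :: "nat ^ 'n"
    assume "total_degree m < M"
    then show "coeff (forest_series f u g) m = 0"
      using forest_series_cong_taylor [of "total_degree m" g]
        vanishes_taylor [of "tree_field (total_degree m)" M g "total_degree m", OF vanishes_tree_field g]
      by (simp add: cong_mod_iff vanishes_def)
  qed
qed (rule forest_series_X_in_G)

text \<open>The coefficient belonging to \<open>\<eta>\<close> is a sum over the trees of weight \<open>\<eta>\<close>.  All of these have the grade \<open>|\<eta>|\<close>,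
  so the bounds on the character and on the decorations are common factors, and the
  majorant series bounds what is left.\<close>

lemma norm_coeff_forest_series_X_le:
  fixes C :: real
  assumes b: "\<And>\<eta>. \<eta> \<in> H \<Longrightarrow> 0 \<le> b \<eta>"
    and supermult: "\<And>\<eta> \<zeta>. \<eta> \<in> H \<Longrightarrow> \<zeta> \<in> H \<Longrightarrow> \<eta> + \<zeta> \<in> H \<Longrightarrow> b \<eta> * b \<zeta> \<le> b (\<eta> + \<zeta>)"
    and u_bound: "\<And>i \<eta>. \<eta> \<in> H \<Longrightarrow> norm (u i \<eta>) \<le> b \<eta>"
    and "C > 0"
    and f_bound: "\<And>F. F \<in> forests_plus \<Longrightarrow> norm (f (basis_forest F)) \<le> C powi gr F"
    and \<eta>: "\<eta> \<in> H" "vint m = \<eta> + axis i 1" "2 \<le> total_degree m"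
  shows "norm (coeff (forest_series f u (X i)) m) \<le>
    b \<eta> * (C * (16 * (real CARD('n) * 2 ^ CARD('n)))) powi deg \<eta>"
proof -
  let ?N = "total_degree m" and ?K = "16 * (real CARD('n) * 2 ^ CARD('n))"
  let ?S = "{T \<in> trees_plus_upto ?N. weight T = \<eta>}"
  let ?t = "\<lambda>T. coeff (const (f (basis_forest {#T#})) * rho_tree u T (X i)) m"
  have "m \<noteq> axis i 1"
    using \<eta>(3) by auto
  then have "coeff (X i) m = 0"
    by (simp add: X_def monom.rep_eq flip: vint_axis)
  then have "coeff (forest_series f u (X i)) m = (\<Sum>T\<in>trees_plus_upto ?N. ?t T)"
    using forest_series_X_cong [of ?N i] \<eta>(3)
    by (simp add: cong_mod_iff plus_mps.rep_eq tree_field_def coeff_sum)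
  moreover have "norm (?t T) \<le> (if weight T = \<eta> then C powi deg \<eta> * (tree_factor T * b \<eta>) else 0)"
    if "T \<in> trees_plus_upto ?N" for T
  proof -
    from that have T: "T \<in> trees_plus" "set_rtree T \<subseteq> H"
      by (auto simp: trees_plus_upto_def trees_plus_def)
    obtain a where a: "rho_tree u T (X i) = monom a (weight T + axis i 1)"
      "norm a \<le> tree_factor T * deco_prod b T"
      using rho_tree_monom_bounded [where u = u and b = b and i = i, OF u_supp u_bound T(2)] that
      unfolding monom_bounded_def by blast
    have "norm a \<le> tree_factor T * b (weight T)"
      using a(2) mult_left_mono [OF deco_prod_le_weight [OF b supermult T(1)] tree_factor_nonneg [of T]]
      by linarith
    moreover have "norm (f (basis_forest {#T#})) \<le> C powi gr_tree T"
      using f_bound [of "{#T#}"] T(1) by (simp add: forests_plus_def gr_def)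
    ultimately have "norm (f (basis_forest {#T#})) * norm a \<le>
        C powi deg (weight T) * (tree_factor T * b (weight T))"
      unfolding deg_weight using \<open>C > 0\<close> by (intro mult_mono) auto
    then show ?thesis
      by (auto simp: a(1) const_mult_monom monom.rep_eq \<eta>(2) norm_mult)
  qed
  ultimately have "norm (coeff (forest_series f u (X i)) m) \<le>
      (\<Sum>T\<in>trees_plus_upto ?N. if weight T = \<eta> then C powi deg \<eta> * (tree_factor T * b \<eta>) else 0)"
    by (simp add: sum_norm_le)
  also have "\<dots> = (\<Sum>T\<in>?S. C powi deg \<eta> * (tree_factor T * b \<eta>))"
    by (rule sum.inter_filter [symmetric]) (rule finite_trees_plus_upto)
  also have "\<dots> = C powi deg \<eta> * b \<eta> * (\<Sum>T\<in>?S. tree_factor T)"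
    by (simp add: sum_distrib_left ac_simps)
  also have "\<dots> \<le> C powi deg \<eta> * b \<eta> * (\<Sum>T\<in>{T \<in> trees_upto ?N. gr_tree T = deg \<eta>}.
      tree_factor (T :: (int ^ 'n) rtree))"
    using \<open>C > 0\<close> b [OF \<eta>(1)]
    by (intro mult_left_mono sum_mono2)
      (auto simp: finite_trees_upto tree_factor_nonneg deg_weight trees_plus_upto_def)
  also have "\<dots> \<le> C powi deg \<eta> * b \<eta> * ?K powi deg \<eta>"
    using \<open>C > 0\<close> b [OF \<eta>(1)] by (intro mult_left_mono sum_tree_factor_le) auto
  finally show ?thesis
    by (simp add: power_int_mult_distrib ac_simps)
qed

end

theorem theorem10:
  fixes B :: "int ^ 'n::finite \<Rightarrow> real"
    and u :: "'n \<Rightarrow> int ^ 'n \<Rightarrow> complex"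
    and f :: "((int ^ 'n) forest \<Rightarrow>\<^sub>0 complex) \<Rightarrow> complex"
    and A C :: real
  assumes B_nonneg: "\<And>\<eta>. \<eta> \<in> H \<Longrightarrow> 0 \<le> B \<eta>"
    and B_mult: "\<And>\<eta> \<eta>1 \<eta>2. \<eta> \<in> H \<Longrightarrow> \<eta>1 \<in> H \<Longrightarrow> \<eta>2 \<in> H \<Longrightarrow> \<eta> = \<eta>1 + \<eta>2 \<Longrightarrow>
      B \<eta>1 * B \<eta>2 \<le> B \<eta>"
    and u_supp: "\<And>i \<eta>. \<eta> \<notin> H_comp i \<Longrightarrow> u i \<eta> = 0"
    and "A > 0"
    and u_bound: "\<And>i \<eta>. \<eta> \<in> H \<Longrightarrow> norm (u i \<eta>) \<le> B \<eta> * A powi deg \<eta>"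
    and "character f"
    and "C > 0"
    and f_bound: "\<And>F. F \<in> forests_plus \<Longrightarrow> norm (f (basis_forest F)) \<le> C powi gr F"
  shows "(\<exists>!\<phi>. \<phi> \<in> G \<and> Theta \<phi> = forest_series f u) \<and>
    (\<forall>\<phi>\<in>G. Theta \<phi> = forest_series f u \<longrightarrow> \<phi> \<in> G_weighted B)"
proof (intro conjI ballI impI)
  let ?L = "forest_series f u"
  show "\<exists>!\<phi>. \<phi> \<in> G \<and> Theta \<phi> = ?L"
  proof (rule ex1I [of _ "\<lambda>i. ?L (X i)"])
    show "(\<lambda>i. ?L (X i)) \<in> G \<and> Theta (\<lambda>i. ?L (X i)) = ?L"
      using forest_series_X_in_G [of u f] forest_series_eq_Theta [of u f] u_supp \<open>character f\<close>
      by simp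
    show "\<phi> = (\<lambda>i. ?L (X i))" if "\<phi> \<in> G \<and> Theta \<phi> = ?L" for \<phi>
      using that Theta_X [of \<phi>] by auto
  qed
  fix \<phi>
  assume \<phi>: "\<phi> \<in> G" "Theta \<phi> = ?L"
  then obtain p where p: "\<phi> = diffeo p"
    by (auto simp: G_def)
  \<comment> \<open>The powers of \<open>A\<close> are multiplicative in \<open>\<eta>\<close>, so they can be absorbed in the weights.\<close>
  let ?b = "\<lambda>\<eta>. B \<eta> * A powi deg \<eta>" and ?K = "16 * (real CARD('n) * 2 ^ CARD('n))"
  have b: "0 \<le> ?b \<eta>" if "\<eta> \<in> H" for \<eta>
    using that B_nonneg \<open>A > 0\<close> by simp
  have supermult: "?b \<eta> * ?b \<zeta> \<le> ?b (\<eta> + \<zeta>)" if "\<eta> \<in> H" "\<zeta> \<in> H" "\<eta> + \<zeta> \<in> H" for \<eta> \<zeta>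
  proof -
    have "?b \<eta> * ?b \<zeta> = B \<eta> * B \<zeta> * A powi deg (\<eta> + \<zeta>)"
      using \<open>A > 0\<close> by (simp add: deg_add power_int_add)
    also have "\<dots> \<le> ?b (\<eta> + \<zeta>)"
      using \<open>A > 0\<close> that by (intro mult_right_mono B_mult) auto
    finally show ?thesis .
  qed
  have "norm (p i \<eta>) \<le> B \<eta> * (A * (C * ?K)) powi deg \<eta>" if \<eta>: "\<eta> \<in> H_comp i" for i \<eta>
  proof -
    from \<eta> obtain m where m: "\<eta> = vint m - axis i 1" "2 \<le> total_degree m"
      by (auto simp: H_comp_def)
    have "\<eta> \<in> H"
      using \<eta> by (auto simp: H_def)
    have "p i \<eta> = coeff (\<phi> i) m"
      using m by (simp add: p coeff_diffeo)
    also have "\<dots> = coeff (?L (X i)) m"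
      using Theta_X [OF \<phi>(1), of i] \<phi>(2) by simp
    finally have "norm (p i \<eta>) \<le> ?b \<eta> * (C * ?K) powi deg \<eta>"
      using norm_coeff_forest_series_X_le [of u f ?b C \<eta> m i, OF u_supp \<open>character f\<close> b supermult
          u_bound \<open>C > 0\<close> f_bound \<open>\<eta> \<in> H\<close>] m by simp
    then show ?thesis
      by (simp add: power_int_mult_distrib ac_simps)
  qed
  moreover have "0 < A * (C * ?K)"
    using \<open>A > 0\<close> \<open>C > 0\<close> by simp
  ultimately show "\<phi> \<in> G_weighted B"
    unfolding G_weighted_def p by blast
qed

end
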